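(* The interface bilinear form $b(\lambda_h,\eta)=\sum_{i=1}^n b_i(\lambda_h,\eta)$, $$b_i(\lambda_h,\eta)=(A\sigma^*_{h,i}(\lambda_h),\eta)_{\Omega_i}+(u^*_{h,i}(\lambda_h),\operatorname{div}\eta)_{\Omega_i}+(\gamma^*_{h,i}(\lambda_h),\eta)_{\Omega_i},$$ is symmetric and positive definite over $\mathbb{X}_{h,0}^\Gamma$.
   Context: Setting. Let $d\in\{2,3\}$ and let $\Omega\subset\mathbb{R}^d$ be a simply connected bounded polygonal domain with outward unit normal $n$ and $\partial\Omega=\Gamma_D\cup\Gamma_N$, $\operatorname{meas}(\Gamma_D)>0$. Let $\mathbb{M},\mathbb{S},\mathbb{N}$ be the spaces of real $d\times d$ matrices, symmetric matrices and skew-symmetric matrices. The compliance tensor $A=A(x)$ is, at each $x\in\Omega$, a self-adjoint, bounded, uniformly positive definite linear operator $\mathbb{S}\to\mathbb{S}$, extended to an operator $\mathbb{M}\to\mathbb{M}$ with the same properties. The divergence of a matrix field is taken row-wise. $(\cdot,\cdot)_G$ is the $L^2(G)$ inner product and $\langle\cdot,\cdot\rangle_S$ the $L^2(S)$ inner product (or duality pairing) on a portion $S$ of a (subdomain) boundary. Put $\mathbb{X}=\{\tau\in H(\operatorname{div};\Omega,\mathbb{M}):\tau n=0\text{ on }\Gamma_N\}$, $V=L^2(\Omega,\mathbb{R}^d)$, $\mathbb{W}=L^2(\Omega,\mathbb{N})$. Finite element spaces. $\mathcal{T}_h$ is a conforming, shape regular, quasi-uniform partition of $\Omega$ into simplices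 or rectangular elements, $h$ is the mesh size, and $\mathbb{X}_h\times V_h\times\mathbb{W}_h\subset\mathbb{X}\times V\times\mathbb{W}$ is any stable triple of mixed finite element spaces on $\mathcal{T}_h$ for linear elasticity with weakly imposed stress symmetry, such as the Amara–Thomas, PEERS, Stenberg, Arnold–Falk–Winther (and its rectangular/quadrilateral analogues), or Cockburn–Gopalakrishnan–Guzmán families. For these spaces $\operatorname{div}\mathbb{X}_h=V_h$. Domain decomposition. $\Omega=\cup_{i=1}^n\Omega_i$ is a union of nonoverlapping shape regular polygonal subdomains (compatible with $\mathcal{T}_h$), $n_i$ is the outward unit normal on $\partial\Omega_i$, $\Gamma_{i,j}=\partial\Omega_i\cap\partial\Omega_j$, $\Gamma=\cup_{i,j}\Gamma_{i,j}$, $\Gamma_i=\partial\Omega_i\cap\Gamma=\partial\Omega_i\setminus\partial\Omega$. $\mathbb{X}_{h,i},V_{h,i},\mathbb{W}_{h,i}$ are the restrictions of $\mathbb{X}_h,V_h,\mathbb{W}_h$ to $\Omega_i$. Let $\mathbb{X}_{h,i}^0=\{\tau\in\mathbb{X}_{h,i}:\tau n=0\text{ on }\Gamma\}$ and let $\mathbb{X}_h^\Gamma$ be the complementary subspace, $\mathbb{X}_h=\mathbb{X}_{h,1}^0\oplus\cdots\oplus\mathbb{X}_{h,n}^0\oplus\mathbb{X}_h^\Gamma$. With $\mathbb{RM}(\Omega_i)$ the space of rigid body motions on $\Omega_i$, $$\mathbb{X}_{h,0}^\Gamma=\{\eta\in\mathbb{X}_h^\Gamma:\langle\eta\,n_i,\chi\rangle_{\Gamma_i}=0\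 \ \forall\chi\in\mathbb{RM}(\Omega_i),\ \forall i\text{ such that }\operatorname{meas}(\partial\Omega_i\cap\Gamma_D)=0\}.$$ For $\lambda_h\in\mathbb{X}_{h,0}^\Gamma$, $(\sigma^*_{h,i}(\lambda_h),u^*_{h,i}(\lambda_h),\gamma^*_{h,i}(\lambda_h))\in\mathbb{X}_{h,i}\times V_{h,i}\times\mathbb{W}_{h,i}$ solves $$(A\sigma^*_{h,i}(\lambda_h),\tau)_{\Omega_i}+(u^*_{h,i}(\lambda_h),\operatorname{div}\tau)_{\Omega_i}+(\gamma^*_{h,i}(\lambda_h),\tau)_{\Omega_i}=0\quad\forall\tau\in\mathbb{X}^0_{h,i},$$ $$(\operatorname{div}\sigma^*_{h,i}(\lambda_h),v)_{\Omega_i}=0\ \ \forall v\in V_{h,i},\qquad(\sigma^*_{h,i}(\lambda_h),\xi)_{\Omega_i}=0\ \ \forall\xi\in\mathbb{W}_{h,i},\qquad\sigma^*_{h,i}(\lambda_h)n_i=\lambda_hn_i\ \text{on }\Gamma_i.$$ On subdomains with $\operatorname{meas}(\partial\Omega_i\cap\Gamma_D)=0$ this problem is singular (displacement and rotation are determined only up to its kernel); any solution may be used in $b_i$ on $\mathbb{X}^\Gamma_{h,0}$. *)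

theory Defs
  imports "HOL-Analysis.Analysis"
begin

text \<open>
  Fields on a domain \<open>G\<close> are functions on the whole of \<open>real ^ 'n\<close>; their values outside \<open>G\<close> are
  irrelevant, and two fields that agree almost everywhere on \<open>G\<close> represent the same element of
  \<open>L2 G\<close>.  All function spaces below are closed under this relation, and equalities and direct sums
  of function spaces are meant modulo it.  Matrices are \<open>real ^ 'n ^ 'n\<close>, so that \<open>\<bullet>\<close> is the
  Frobenius inner product.
\<close>

section \<open>Lebesgue and Sobolev spaces\<close>

definition ae_eq :: "(real ^ 'n) set \<Rightarrow> (real ^ 'n \<Rightarrow> 'b) \<Rightarrow> (real ^ 'n \<Rightarrow> 'b) \<Rightarrow> bool" where
  "ae_eq G f g \<longleftrightarrow> (AE x in lebesgue_on G. f x = g x)"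

definition L2 :: "(real ^ 'n) set \<Rightarrow> (real ^ 'n \<Rightarrow> 'b::euclidean_space) set" where
  "L2 G = {f. f \<in> borel_measurable (lebesgue_on G) \<and>
              integrable (lebesgue_on G) (\<lambda>x. (norm (f x))\<^sup>2)}"

definition ip :: "(real ^ 'n) set \<Rightarrow> (real ^ 'n \<Rightarrow> 'b::euclidean_space) \<Rightarrow> (real ^ 'n \<Rightarrow> 'b) \<Rightarrow> real" where
  "ip G f g = (\<integral>x. f x \<bullet> g x \<partial>lebesgue_on G)"

definition L2_norm :: "(real ^ 'n) set \<Rightarrow> (real ^ 'n \<Rightarrow> 'b::euclidean_space) \<Rightarrow> real" where
  "L2_norm G f = sqrt (ip G f f)"

text \<open>The entry \<open>(i, j)\<close> of \<open>jacobian \<phi> (at x)\<close> is the \<open>j\<close>-th partial derivative of the \<open>i\<close>-th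
  component, so the divergence defined by duality with it is the row-wise one.\<close>

definition C1_field :: "(real ^ 'n \<Rightarrow> real ^ 'n) \<Rightarrow> bool" where
  "C1_field \<phi> \<longleftrightarrow> (\<forall>x. \<phi> differentiable (at x)) \<and>
                 continuous_on UNIV (\<lambda>x. jacobian \<phi> (at x))"

definition is_weak_div ::
  "(real ^ 'n) set \<Rightarrow> (real ^ 'n \<Rightarrow> real ^ 'n ^ 'n) \<Rightarrow> (real ^ 'n \<Rightarrow> real ^ 'n) \<Rightarrow> bool" where
  "is_weak_div G \<tau> g \<longleftrightarrow> g \<in> L2 G \<and>
     (\<forall>\<phi>. C1_field \<phi> \<and> compact (closure {x. \<phi> x \<noteq> 0}) \<and> closure {x. \<phi> x \<noteq> 0} \<subseteq> G \<longrightarrow>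
          ip G \<tau> (\<lambda>x. jacobian \<phi> (at x)) = - ip G g \<phi>)"

definition Hdiv :: "(real ^ 'n) set \<Rightarrow> (real ^ 'n \<Rightarrow> real ^ 'n ^ 'n) set" where
  "Hdiv G = {\<tau> \<in> L2 G. \<exists>g. is_weak_div G \<tau> g}"

text \<open>The weak divergence is unique only almost everywhere; \<open>wdiv\<close> picks a representative.\<close>

definition wdiv ::
  "(real ^ 'n) set \<Rightarrow> (real ^ 'n \<Rightarrow> real ^ 'n ^ 'n) \<Rightarrow> (real ^ 'n \<Rightarrow> real ^ 'n)" where
  "wdiv G \<tau> = (SOME g. is_weak_div G \<tau> g)"

definition Hdiv_norm :: "(real ^ 'n) set \<Rightarrow> (real ^ 'n \<Rightarrow> real ^ 'n ^ 'n) \<Rightarrow> real" where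
  "Hdiv_norm G \<tau> = sqrt ((L2_norm G \<tau>)\<^sup>2 + (L2_norm G (wdiv G \<tau>))\<^sup>2)"

text \<open>The normal trace of \<open>\<tau> \<in> Hdiv G\<close> as a functional on the boundary, given by Green's formula:
  \<open>normal_pairing G \<tau> \<phi>\<close> is the duality pairing of \<open>\<tau> n\<close> and \<open>\<phi>\<close> on \<open>frontier G\<close>.  Statements about
  \<open>\<tau> n\<close> on a portion \<open>S\<close> of the boundary use test fields vanishing on the remaining portion.\<close>

definition normal_pairing ::
  "(real ^ 'n) set \<Rightarrow> (real ^ 'n \<Rightarrow> real ^ 'n ^ 'n) \<Rightarrow> (real ^ 'n \<Rightarrow> real ^ 'n) \<Rightarrow> real" where
  "normal_pairing G \<tau> \<phi> = ip G (wdiv G \<tau>) \<phi> + ip G \<tau> (\<lambda>x. jacobian \<phi> (at x))"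

definition portion_tests :: "(real ^ 'n) set \<Rightarrow> (real ^ 'n) set \<Rightarrow> (real ^ 'n \<Rightarrow> real ^ 'n) set" where
  "portion_tests G S = {\<phi>. C1_field \<phi> \<and> (\<forall>x \<in> frontier G - S. \<phi> x = 0)}"

definition normal_trace_zero ::
  "(real ^ 'n) set \<Rightarrow> (real ^ 'n) set \<Rightarrow> (real ^ 'n \<Rightarrow> real ^ 'n ^ 'n) \<Rightarrow> bool" where
  "normal_trace_zero G S \<tau> \<longleftrightarrow> (\<forall>\<phi> \<in> portion_tests G S. normal_pairing G \<tau> \<phi> = 0)"

definition normal_trace_eq ::
  "(real ^ 'n) set \<Rightarrow> (real ^ 'n) set \<Rightarrow>
   (real ^ 'n \<Rightarrow> real ^ 'n ^ 'n) \<Rightarrow> (real ^ 'n \<Rightarrow> real ^ 'n ^ 'n) \<Rightarrow> bool" where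
  "normal_trace_eq G S \<sigma> \<tau> \<longleftrightarrow>
     (\<forall>\<phi> \<in> portion_tests G S. normal_pairing G \<sigma> \<phi> = normal_pairing G \<tau> \<phi>)"

definition stress_space ::
  "(real ^ 'n) set \<Rightarrow> (real ^ 'n) set \<Rightarrow> (real ^ 'n \<Rightarrow> real ^ 'n ^ 'n) set" where
  "stress_space \<Omega> \<Gamma>N = {\<tau> \<in> Hdiv \<Omega>. normal_trace_zero \<Omega> \<Gamma>N \<tau>}"

definition rotation_space :: "(real ^ 'n) set \<Rightarrow> (real ^ 'n \<Rightarrow> real ^ 'n ^ 'n) set" where
  "rotation_space \<Omega> = {q \<in> L2 \<Omega>. AE x in lebesgue_on \<Omega>. transpose (q x) = - q x}"

definition rigid_motions :: "(real ^ 'n \<Rightarrow> real ^ 'n) set" where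
  "rigid_motions = {\<rho>. \<exists>a B. transpose B = - B \<and> \<rho> = (\<lambda>x. a + B *v x)}"

section \<open>Geometry\<close>

text \<open>The last condition puts the domain on one side of its boundary and so excludes slits.\<close>

definition polygonal_domain :: "(real ^ 'n) set \<Rightarrow> bool" where
  "polygonal_domain G \<longleftrightarrow> G \<noteq> {} \<and> open G \<and> connected G \<and> bounded G \<and>
     (\<exists>P. finite P \<and> (\<forall>p \<in> P. polytope p) \<and> closure G = \<Union>P) \<and>
     interior (closure G) = G"

text \<open>Vanishing of the \<open>(d-1)\<close>-dimensional Hausdorff measure.\<close>

definition surface_null :: "(real ^ 'n) set \<Rightarrow> bool" where
  "surface_null S \<longleftrightarrow>
     (\<forall>\<epsilon>>0. \<exists>U :: nat \<Rightarrow> (real ^ 'n) set.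
        S \<subseteq> (\<Union>k. U k) \<and> (\<forall>k. bounded (U k)) \<and>
        summable (\<lambda>k. diameter (U k) ^ (CARD('n) - 1)) \<and>
        (\<Sum>k. diameter (U k) ^ (CARD('n) - 1)) < \<epsilon>)"

definition shape_regular :: "real \<Rightarrow> (real ^ 'n) set \<Rightarrow> bool" where
  "shape_regular \<kappa> K \<longleftrightarrow> (\<exists>a r. 0 < r \<and> cball a r \<subseteq> K \<and> diameter K \<le> \<kappa> * r)"

definition rectangular_element :: "(real ^ 'n) set \<Rightarrow> bool" where
  "rectangular_element K \<longleftrightarrow>
     (\<exists>(Q :: real ^ 'n \<Rightarrow> real ^ 'n) a b. orthogonal_transformation Q \<and> box a b \<noteq> {} \<and> K = Q ` cbox a b)"

definition conforming_mesh :: "(real ^ 'n) set \<Rightarrow> (real ^ 'n) set set \<Rightarrow> bool" where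
  "conforming_mesh \<Omega> T \<longleftrightarrow> finite T \<and> closure \<Omega> = \<Union>T \<and>
     ((\<forall>K \<in> T. int CARD('n) simplex K) \<or> (\<forall>K \<in> T. rectangular_element K)) \<and>
     (\<forall>K \<in> T. \<forall>K' \<in> T. (K \<inter> K') face_of K \<and> (K \<inter> K') face_of K')"

text \<open>\<open>\<kappa>\<close> bounds both the shape regularity and the quasi-uniformity of the mesh of size \<open>h\<close>.\<close>

definition regular_mesh :: "real \<Rightarrow> real \<Rightarrow> (real ^ 'n) set set \<Rightarrow> bool" where
  "regular_mesh \<kappa> h T \<longleftrightarrow> h = Max (diameter ` T) \<and>
     (\<forall>K \<in> T. shape_regular \<kappa> K \<and> h \<le> \<kappa> * diameter K)"

definition domain_decomposition ::
  "real \<Rightarrow> (real ^ 'n) set \<Rightarrow> (real ^ 'n) set set \<Rightarrow> nat \<Rightarrow> (nat \<Rightarrow> (real ^ 'n) set) \<Rightarrow> bool" where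
  "domain_decomposition \<kappa> \<Omega> T n \<Omega>s \<longleftrightarrow>
     (\<forall>i \<in> {1..n}. polygonal_domain (\<Omega>s i) \<and> shape_regular \<kappa> (\<Omega>s i) \<and>
                   (\<exists>T' \<subseteq> T. closure (\<Omega>s i) = \<Union>T')) \<and>
     (\<forall>i \<in> {1..n}. \<forall>j \<in> {1..n}. i \<noteq> j \<longrightarrow> \<Omega>s i \<inter> \<Omega>s j = {}) \<and>
     closure \<Omega> = (\<Union>i \<in> {1..n}. closure (\<Omega>s i))"

definition interface :: "nat \<Rightarrow> (nat \<Rightarrow> (real ^ 'n) set) \<Rightarrow> (real ^ 'n) set" where
  "interface n \<Omega>s =
     (\<Union>i \<in> {1..n}. \<Union>j \<in> {1..n} - {i}. frontier (\<Omega>s i) \<inter> frontier (\<Omega>s j))"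

definition local_interface :: "nat \<Rightarrow> (nat \<Rightarrow> (real ^ 'n) set) \<Rightarrow> nat \<Rightarrow> (real ^ 'n) set" where
  "local_interface n \<Omega>s i = frontier (\<Omega>s i) \<inter> interface n \<Omega>s"

section \<open>Compliance tensor\<close>

definition compliance_tensor ::
  "(real ^ 'n) set \<Rightarrow> (real ^ 'n \<Rightarrow> real ^ 'n ^ 'n \<Rightarrow> real ^ 'n ^ 'n) \<Rightarrow> bool" where
  "compliance_tensor \<Omega> A \<longleftrightarrow>
     (\<forall>x \<in> \<Omega>. linear (A x) \<and>
        (\<forall>\<sigma> \<tau>. A x \<sigma> \<bullet> \<tau> = \<sigma> \<bullet> A x \<tau>) \<and>
        (\<forall>\<tau>. transpose \<tau> = \<tau> \<longrightarrow> transpose (A x \<tau>) = A x \<tau>)) \<and>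
     (\<exists>\<alpha>. \<forall>x \<in> \<Omega>. \<forall>\<tau>. norm (A x \<tau>) \<le> \<alpha> * norm \<tau>) \<and>
     (\<exists>\<alpha>>0. \<forall>x \<in> \<Omega>. \<forall>\<tau>. \<alpha> * (norm \<tau>)\<^sup>2 \<le> A x \<tau> \<bullet> \<tau>) \<and>
     (\<forall>\<tau>. (\<lambda>x. A x \<tau>) \<in> borel_measurable (lebesgue_on \<Omega>))"

section \<open>Finite element spaces\<close>

definition field_subspace :: "(real ^ 'n) set \<Rightarrow> (real ^ 'n \<Rightarrow> 'b::real_vector) set \<Rightarrow> bool" where
  "field_subspace G S \<longleftrightarrow>
     (\<lambda>x. 0) \<in> S \<and>
     (\<forall>f \<in> S. \<forall>g \<in> S. (\<lambda>x. f x + g x) \<in> S) \<and>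
     (\<forall>f \<in> S. \<forall>c. (\<lambda>x. c *\<^sub>R f x) \<in> S) \<and>
     (\<forall>f \<in> S. \<forall>g. ae_eq G g f \<longrightarrow> g \<in> S)"

text \<open>Finite-dimensional spaces of fields that are polynomial on each mesh element.\<close>

definition fe_space ::
  "(real ^ 'n) set \<Rightarrow> (real ^ 'n) set set \<Rightarrow> (real ^ 'n \<Rightarrow> 'b::euclidean_space) set \<Rightarrow> bool" where
  "fe_space \<Omega> T S \<longleftrightarrow> field_subspace \<Omega> S \<and>
     (\<forall>f \<in> S. \<forall>K \<in> T. \<exists>p. polynomial_function p \<and> ae_eq K f p) \<and>
     (\<exists>B. finite B \<and> B \<subseteq> S \<and> (\<forall>f \<in> S. \<exists>c. ae_eq \<Omega> f (\<lambda>x. \<Sum>g \<in> B. c g *\<^sub>R g x)))"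

text \<open>Brezzi's stability conditions for weakly symmetric elasticity, with constants \<open>c1\<close>, \<open>c2\<close>.\<close>

definition stable_triple ::
  "real \<Rightarrow> real \<Rightarrow> (real ^ 'n) set \<Rightarrow> (real ^ 'n \<Rightarrow> real ^ 'n ^ 'n \<Rightarrow> real ^ 'n ^ 'n) \<Rightarrow>
   (real ^ 'n \<Rightarrow> real ^ 'n ^ 'n) set \<Rightarrow> (real ^ 'n \<Rightarrow> real ^ 'n) set \<Rightarrow>
   (real ^ 'n \<Rightarrow> real ^ 'n ^ 'n) set \<Rightarrow> bool" where
  "stable_triple c1 c2 \<Omega> A Xh Vh Wh \<longleftrightarrow>
     (\<forall>\<tau> \<in> Xh. (\<forall>v \<in> Vh. \<forall>q \<in> Wh. ip \<Omega> (wdiv \<Omega> \<tau>) v + ip \<Omega> \<tau> q = 0) \<longrightarrow>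
        c1 * (Hdiv_norm \<Omega> \<tau>)\<^sup>2 \<le> ip \<Omega> (\<lambda>x. A x (\<tau> x)) \<tau>) \<and>
     (\<forall>v \<in> Vh. \<forall>q \<in> Wh. \<not> (ae_eq \<Omega> v (\<lambda>x. 0) \<and> ae_eq \<Omega> q (\<lambda>x. 0)) \<longrightarrow>
        (\<exists>\<tau> \<in> Xh. \<not> ae_eq \<Omega> \<tau> (\<lambda>x. 0) \<and>
           c2 * Hdiv_norm \<Omega> \<tau> * (L2_norm \<Omega> v + L2_norm \<Omega> q)
             \<le> ip \<Omega> (wdiv \<Omega> \<tau>) v + ip \<Omega> \<tau> q))"

definition div_onto ::
  "(real ^ 'n) set \<Rightarrow> (real ^ 'n \<Rightarrow> real ^ 'n ^ 'n) set \<Rightarrow> (real ^ 'n \<Rightarrow> real ^ 'n) set \<Rightarrow> bool" where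
  "div_onto \<Omega> Xh Vh \<longleftrightarrow> {v. \<exists>\<tau> \<in> Xh. ae_eq \<Omega> v (wdiv \<Omega> \<tau>)} = Vh"

definition restriction ::
  "(real ^ 'n) set \<Rightarrow> (real ^ 'n \<Rightarrow> 'b) set \<Rightarrow> (real ^ 'n \<Rightarrow> 'b) set" where
  "restriction G S = {g. \<exists>f \<in> S. ae_eq G g f}"

definition zero_ext :: "(real ^ 'n) set \<Rightarrow> (real ^ 'n \<Rightarrow> 'b::zero) \<Rightarrow> (real ^ 'n \<Rightarrow> 'b)" where
  "zero_ext G f = (\<lambda>x. if x \<in> G then f x else 0)"

definition local_stress0 ::
  "nat \<Rightarrow> (nat \<Rightarrow> (real ^ 'n) set) \<Rightarrow> (real ^ 'n \<Rightarrow> real ^ 'n ^ 'n) set \<Rightarrow> nat \<Rightarrow>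
   (real ^ 'n \<Rightarrow> real ^ 'n ^ 'n) set" where
  "local_stress0 n \<Omega>s Xh i =
     {\<tau> \<in> restriction (\<Omega>s i) Xh. normal_trace_zero (\<Omega>s i) (local_interface n \<Omega>s i) \<tau>}"

text \<open>\<open>Xh\<close> is the internal direct sum of the spaces \<open>local_stress0\<close>, extended by zero, and of
  \<open>X\<Gamma>\<close>.\<close>

definition interface_complement ::
  "(real ^ 'n) set \<Rightarrow> nat \<Rightarrow> (nat \<Rightarrow> (real ^ 'n) set) \<Rightarrow>
   (real ^ 'n \<Rightarrow> real ^ 'n ^ 'n) set \<Rightarrow> (real ^ 'n \<Rightarrow> real ^ 'n ^ 'n) set \<Rightarrow> bool" where
  "interface_complement \<Omega> n \<Omega>s Xh X\<Gamma> \<longleftrightarrow>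
     field_subspace \<Omega> X\<Gamma> \<and> X\<Gamma> \<subseteq> Xh \<and>
     (\<forall>i \<in> {1..n}. zero_ext (\<Omega>s i) ` local_stress0 n \<Omega>s Xh i \<subseteq> Xh) \<and>
     (\<forall>\<sigma> \<in> Xh. \<exists>\<tau> \<eta>. (\<forall>i \<in> {1..n}. \<tau> i \<in> local_stress0 n \<Omega>s Xh i) \<and> \<eta> \<in> X\<Gamma> \<and>
        ae_eq \<Omega> \<sigma> (\<lambda>x. (\<Sum>i \<in> {1..n}. zero_ext (\<Omega>s i) (\<tau> i) x) + \<eta> x)) \<and>
     (\<forall>\<tau> \<eta>. (\<forall>i \<in> {1..n}. \<tau> i \<in> local_stress0 n \<Omega>s Xh i) \<and> \<eta> \<in> X\<Gamma> \<and>
        ae_eq \<Omega> (\<lambda>x. (\<Sum>i \<in> {1..n}. zero_ext (\<Omega>s i) (\<tau> i) x) + \<eta> x) (\<lambda>x. 0) \<longrightarrow>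
        (\<forall>i \<in> {1..n}. ae_eq (\<Omega>s i) (\<tau> i) (\<lambda>x. 0)) \<and> ae_eq \<Omega> \<eta> (\<lambda>x. 0))"

text \<open>If \<open>frontier (\<Omega>s i) \<inter> \<Gamma>D\<close> has zero surface measure, then \<open>\<eta> n\<close> vanishes on the part of
  \<open>frontier (\<Omega>s i)\<close> outside the interface for every \<open>\<eta> \<in> Xh\<close>, because that part lies in \<open>\<Gamma>N\<close>.
  The pairing of \<open>\<eta> n\<close> with \<open>\<rho>\<close> on the interface portion is therefore the pairing on the whole of
  \<open>frontier (\<Omega>s i)\<close>.\<close>

definition interface_space0 ::
  "(real ^ 'n) set \<Rightarrow> nat \<Rightarrow> (nat \<Rightarrow> (real ^ 'n) set) \<Rightarrow>
   (real ^ 'n \<Rightarrow> real ^ 'n ^ 'n) set \<Rightarrow> (real ^ 'n \<Rightarrow> real ^ 'n ^ 'n) set" where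
  "interface_space0 \<Gamma>D n \<Omega>s X\<Gamma> =
     {\<eta> \<in> X\<Gamma>. \<forall>i \<in> {1..n}. surface_null (frontier (\<Omega>s i) \<inter> \<Gamma>D) \<longrightarrow>
                 (\<forall>\<rho> \<in> rigid_motions. normal_pairing (\<Omega>s i) \<eta> \<rho> = 0)}"

section \<open>Local problems and the interface form\<close>

definition local_solution ::
  "(real ^ 'n \<Rightarrow> real ^ 'n ^ 'n \<Rightarrow> real ^ 'n ^ 'n) \<Rightarrow> nat \<Rightarrow> (nat \<Rightarrow> (real ^ 'n) set) \<Rightarrow>
   (real ^ 'n \<Rightarrow> real ^ 'n ^ 'n) set \<Rightarrow> (real ^ 'n \<Rightarrow> real ^ 'n) set \<Rightarrow>
   (real ^ 'n \<Rightarrow> real ^ 'n ^ 'n) set \<Rightarrow> nat \<Rightarrow> (real ^ 'n \<Rightarrow> real ^ 'n ^ 'n) \<Rightarrow>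
   (real ^ 'n \<Rightarrow> real ^ 'n ^ 'n) \<Rightarrow> (real ^ 'n \<Rightarrow> real ^ 'n) \<Rightarrow>
   (real ^ 'n \<Rightarrow> real ^ 'n ^ 'n) \<Rightarrow> bool" where
  "local_solution A n \<Omega>s Xh Vh Wh i \<mu> \<sigma> u \<gamma> \<longleftrightarrow>
     \<sigma> \<in> restriction (\<Omega>s i) Xh \<and> u \<in> restriction (\<Omega>s i) Vh \<and> \<gamma> \<in> restriction (\<Omega>s i) Wh \<and>
     (\<forall>\<tau> \<in> local_stress0 n \<Omega>s Xh i.
        ip (\<Omega>s i) (\<lambda>x. A x (\<sigma> x)) \<tau> + ip (\<Omega>s i) u (wdiv (\<Omega>s i) \<tau>) + ip (\<Omega>s i) \<gamma> \<tau> = 0) \<and>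
     (\<forall>v \<in> restriction (\<Omega>s i) Vh. ip (\<Omega>s i) (wdiv (\<Omega>s i) \<sigma>) v = 0) \<and>
     (\<forall>\<xi> \<in> restriction (\<Omega>s i) Wh. ip (\<Omega>s i) \<sigma> \<xi> = 0) \<and>
     normal_trace_eq (\<Omega>s i) (local_interface n \<Omega>s i) \<sigma> \<mu>"

definition interface_form ::
  "(real ^ 'n \<Rightarrow> real ^ 'n ^ 'n \<Rightarrow> real ^ 'n ^ 'n) \<Rightarrow> nat \<Rightarrow> (nat \<Rightarrow> (real ^ 'n) set) \<Rightarrow>
   (nat \<Rightarrow> (real ^ 'n \<Rightarrow> real ^ 'n ^ 'n) \<Rightarrow> (real ^ 'n \<Rightarrow> real ^ 'n ^ 'n)) \<Rightarrow>
   (nat \<Rightarrow> (real ^ 'n \<Rightarrow> real ^ 'n ^ 'n) \<Rightarrow> (real ^ 'n \<Rightarrow> real ^ 'n)) \<Rightarrow>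
   (nat \<Rightarrow> (real ^ 'n \<Rightarrow> real ^ 'n ^ 'n) \<Rightarrow> (real ^ 'n \<Rightarrow> real ^ 'n ^ 'n)) \<Rightarrow>
   (real ^ 'n \<Rightarrow> real ^ 'n ^ 'n) \<Rightarrow> (real ^ 'n \<Rightarrow> real ^ 'n ^ 'n) \<Rightarrow> real" where
  "interface_form A n \<Omega>s \<sigma> u \<gamma> \<mu> \<eta> =
     (\<Sum>i \<in> {1..n}. ip (\<Omega>s i) (\<lambda>x. A x (\<sigma> i \<mu> x)) \<eta>
                 + ip (\<Omega>s i) (u i \<mu>) (wdiv (\<Omega>s i) \<eta>)
                 + ip (\<Omega>s i) (\<gamma> i \<mu>) \<eta>)"

definition bilinear_form_on ::
  "(real ^ 'n \<Rightarrow> 'b::real_vector) set \<Rightarrow> ((real ^ 'n \<Rightarrow> 'b) \<Rightarrow> (real ^ 'n \<Rightarrow> 'b) \<Rightarrow> real) \<Rightarrow> bool" where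
  "bilinear_form_on S b \<longleftrightarrow>
     (\<forall>f \<in> S. \<forall>g \<in> S. \<forall>k \<in> S. b (\<lambda>x. f x + g x) k = b f k + b g k \<and>
                            b k (\<lambda>x. f x + g x) = b k f + b k g) \<and>
     (\<forall>f \<in> S. \<forall>k \<in> S. \<forall>c. b (\<lambda>x. c *\<^sub>R f x) k = c * b f k \<and> b k (\<lambda>x. c *\<^sub>R f x) = c * b k f)"

definition symmetric_on :: "'a set \<Rightarrow> ('a \<Rightarrow> 'a \<Rightarrow> real) \<Rightarrow> bool" where
  "symmetric_on S b \<longleftrightarrow> (\<forall>f \<in> S. \<forall>g \<in> S. b f g = b g f)"

definition positive_definite_on ::
  "(real ^ 'n) set \<Rightarrow> (real ^ 'n \<Rightarrow> 'b::zero) set \<Rightarrow>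
   ((real ^ 'n \<Rightarrow> 'b) \<Rightarrow> (real ^ 'n \<Rightarrow> 'b) \<Rightarrow> real) \<Rightarrow> bool" where
  "positive_definite_on G S b \<longleftrightarrow>
     (\<forall>f \<in> S. b f f \<ge> 0 \<and> (b f f = 0 \<longleftrightarrow> ae_eq G f (\<lambda>x. 0)))"

end

theory Submission
  imports Defs
begin

text \<open>Testing the local problem with datum \<open>\<mu>\<close> against the difference of the stress with datum
  \<open>\<eta>\<close> and \<open>\<eta>\<close> itself, a stress with zero normal trace on the interface, gives
  \<open>b_i(\<mu>, \<eta>) = (A \<sigma>_i(\<mu>), \<sigma>_i(\<eta>))\<close>.  Hence \<open>b\<close> is symmetric and nonnegative; as it is
  linear in \<open>\<eta>\<close> from the start, it is bilinear, whichever solutions of the singular local problems are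
  chosen.  If \<open>b(\<mu>, \<mu>) = 0\<close>, then every \<open>\<sigma>_i(\<mu>)\<close> vanishes, so \<open>\<mu> n\<close> vanishes on the interface and
  \<open>\<mu>\<close> is a sum of interior stresses; it lies in the complement of these, so \<open>\<mu> = 0\<close>.\<close>

text \<open>The field \<open>wdiv\<close> is a Hilbert choice, so even its additivity holds only
  almost everywhere. Every statement about normal traces or about the divergence term of the form
  therefore rests on uniqueness of the weak divergence against compactly supported C1 fields. That
  is the fundamental lemma of the calculus of variations, obtained here from explicit C1 functions
  on boxes. In the energy identity the displacement and rotation terms disappear because
  \<open>u i \<mu>\<close> and \<open>\<gamma> i \<mu>\<close> lie in the local spaces and are
  admissible tests in the divergence and symmetry constraints on \<open>\<sigma> i \<eta>\<close>.
  In the definiteness argument, \<open>\<mu>\<close> is the sum of its own restrictions to the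
  subdomains only up to a null set: the subdomains miss their frontiers. These are null because a
  polygonal domain has its frontier inside finitely many frontiers of convex polytopes.\<close>

section \<open>Test functions\<close>

text \<open>The open boxes form an intersection-stable generator of the Borel sets, so Dynkin's
  pi-lambda theorem carries the vanishing from boxes to Borel sets; the total integral enters in the
  complement step. A Lebesgue set differs from an F-sigma set by a null set, and a function whose
  set integrals all vanish is zero almost everywhere.\<close>

lemma AE_zero_if_integral_boxes_zero:
  fixes g :: "'a::euclidean_space \<Rightarrow> real"
  assumes g: "integrable lebesgue g" and "integral\<^sup>L lebesgue g = 0"
    and box: "\<And>a b. (LINT x:box a b|lebesgue. g x) = 0"
  shows "AE x in lebesgue. g x = 0"
proof -
  have set_g: "set_integrable lebesgue A g" if "A \<in> sets lebesgue" for A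
    using integrable_mult_indicator[OF that g] by (simp add: set_integrable_def)
  have borel: "(LINT x:A|lebesgue. g x) = 0" if "A \<in> sets borel" for A
  proof -
    have sig: "sigma_sets UNIV (range (\<lambda>(a, b). box a b :: 'a set)) = sets borel"
      by (simp add: borel_eq_box sets_measure_of_conv)
    have Int: "Int_stable (range (\<lambda>(a, b). box a b :: 'a set))"
      by (auto simp: Int_stable_def box_Int_box)
    have sub: "range (\<lambda>(a, b). box a b :: 'a set) \<subseteq> Pow UNIV" by simp
    have "A \<in> sigma_sets UNIV (range (\<lambda>(a, b). box a b :: 'a set))"
      using that sig by simp
    with Int sub show ?thesis
    proof (induction rule: sigma_sets_induct_disjoint)
      case (basic A)
      then show ?case using box by auto
    next
      case (compl A)
      then have "A \<in> sets borel" using sig by simp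
      then have "(LINT x:(UNIV - A) \<union> A|lebesgue. g x) =
          (LINT x:UNIV - A|lebesgue. g x) + (LINT x:A|lebesgue. g x)"
        by (intro set_integral_Un set_g) auto
      moreover have "(UNIV - A) \<union> A = UNIV" by auto
      ultimately show ?case
        using compl assms(2) by (simp add: set_lebesgue_integral_def)
    next
      case (union A)
      then have A: "A i \<in> sets borel" for i
        using sig by auto
      then have "(\<Union>i. A i) \<in> sets borel" by auto
      then have "(LINT x:(\<Union>i. A i)|lebesgue. g x) = (\<Sum>i. (LINT x:A i|lebesgue. g x))"
        using union(1) A
        by (intro lebesgue_integral_countable_add set_g) (auto simp: disjoint_family_on_def)
      then show ?case using union by simp
    qed (auto simp: set_lebesgue_integral_def)
  qed
  have "(LINT x:A|lebesgue. g x) = 0" if A: "A \<in> sets lebesgue" for A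
  proof -
    obtain C N where C: "fsigma C" "N \<in> null_sets lebesgue" "C \<union> N = A"
      using lebesgue_set_almost_fsigma[OF A] by metis
    then have "C \<in> sets borel"
      by (auto simp: fsigma.simps)
    moreover have "(LINT x:A|lebesgue. g x) = (LINT x:C|lebesgue. g x)"
    proof (rule set_integral_cong_set)
      have "AE x in lebesgue. x \<notin> N"
        using C by (auto intro: AE_not_in)
      then show "AE x in lebesgue. (x \<in> C) = (x \<in> A)"
        by eventually_elim (use C in auto)
      show "set_borel_measurable lebesgue C g" "set_borel_measurable lebesgue A g"
        using set_g[of C] set_g[of A] A \<open>C \<in> sets borel\<close>
        unfolding set_integrable_def set_borel_measurable_def
        by (auto intro!: borel_measurable_integrable)
    qed
    ultimately show ?thesis using borel by simp
  qed
  then show ?thesis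
    by (intro density_unique_real[where f' = "\<lambda>x. 0"]) (use g in auto)
qed

text \<open>Continuity of the derivative is asked for in each direction \<open>v\<close> separately.
  In finite dimension this is the usual notion, but the product and chain rules then involve no
  operator norm, and the directions \<open>axis j 1\<close> give the partial derivatives in the
  Jacobian.\<close>

definition C1_scalar :: "(real ^ 'n \<Rightarrow> real) \<Rightarrow> bool" where
  "C1_scalar f \<longleftrightarrow> (\<exists>f'. (\<forall>x. (f has_derivative f' x) (at x)) \<and>
                       (\<forall>v. continuous_on UNIV (\<lambda>x. f' x v)))"

lemma C1_scalar_imp_continuous: "C1_scalar f \<Longrightarrow> continuous_on UNIV f"
  unfolding C1_scalar_def
  by (meson continuous_at_imp_continuous_on has_derivative_continuous)

lemma C1_scalar_mult:
  assumes "C1_scalar f" "C1_scalar g"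
  shows "C1_scalar (\<lambda>x. f x * g x)"
proof -
  obtain f' g' where f: "\<And>x. (f has_derivative f' x) (at x)" "\<And>v. continuous_on UNIV (\<lambda>x. f' x v)"
    and g: "\<And>x. (g has_derivative g' x) (at x)" "\<And>v. continuous_on UNIV (\<lambda>x. g' x v)"
    using assms unfolding C1_scalar_def by blast
  show ?thesis unfolding C1_scalar_def
    by (rule exI[of _ "\<lambda>x v. f x * g' x v + f' x v * g x"])
      (auto intro!: has_derivative_mult continuous_intros f g
        assms[THEN C1_scalar_imp_continuous])
qed

lemma C1_scalar_compose:
  assumes "C1_scalar f" and h: "\<And>t. (h has_real_derivative h' t) (at t)" "continuous_on UNIV h'"
  shows "C1_scalar (\<lambda>x. h (f x))"
proof -
  obtain f' where f: "\<And>x. (f has_derivative f' x) (at x)" "\<And>v. continuous_on UNIV (\<lambda>x. f' x v)"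
    using assms unfolding C1_scalar_def by blast
  have "((\<lambda>x. h (f x)) has_derivative (\<lambda>v. h' (f x) * f' x v)) (at x)" for x
    using has_derivative_compose[OF f(1) h(1)[unfolded has_field_derivative_def]]
    by (simp add: o_def)
  moreover have "continuous_on UNIV (\<lambda>x. h' (f x) * f' x v)" for v
    using continuous_on_compose2[OF h(2) C1_scalar_imp_continuous[OF assms(1)]] f(2)
    by (intro continuous_on_mult) auto
  ultimately show ?thesis unfolding C1_scalar_def by (intro exI conjI allI)
qed

lemma C1_scalar_component: "C1_scalar (\<lambda>x. x $ i)"
  unfolding C1_scalar_def
  by (rule exI[of _ "\<lambda>x v. v $ i"])
    (auto intro!: bounded_linear_imp_has_derivative bounded_linear_vec_nth)

lemma C1_scalar_const: "C1_scalar (\<lambda>x. c)"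
  unfolding C1_scalar_def by (rule exI[of _ "\<lambda>x v. 0"]) auto

lemma C1_scalar_prod:
  assumes "\<And>i. i \<in> I \<Longrightarrow> C1_scalar (f i)"
  shows "C1_scalar (\<lambda>x. \<Prod>i\<in>I. f i x)"
proof (cases "finite I")
  case True
  then show ?thesis using assms
    by (induction I) (auto intro: C1_scalar_mult C1_scalar_const)
next
  \<comment> \<open>Over an infinite index set the product is 1 by convention.\<close>
  case False
  then show ?thesis by (simp add: C1_scalar_const)
qed

text \<open>Test fields of constant direction suffice: with \<open>w = axis i 1\<close> the pairing
  with \<open>g\<close> isolates the component \<open>g x $ i\<close>.\<close>

lemma C1_field_scaleR:
  assumes "C1_scalar f"
  shows "C1_field (\<lambda>x. f x *\<^sub>R w)"
proof -
  obtain f' where f: "\<And>x. (f has_derivative f' x) (at x)" "\<And>v. continuous_on UNIV (\<lambda>x. f' x v)"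
    using assms unfolding C1_scalar_def by blast
  have d: "((\<lambda>x. f x *\<^sub>R w) has_derivative (\<lambda>v. f' x v *\<^sub>R w)) (at x)" for x
    by (intro has_derivative_scaleR_left f)
  have "jacobian (\<lambda>x. f x *\<^sub>R w) (at x) = (\<chi> i j. f' x (axis j 1) * w $ i)" for x
    by (simp add: jacobian_def frechet_derivative_at[OF d, symmetric] matrix_def)
  moreover have "continuous_on UNIV (\<lambda>x. \<chi> i j. f' x (axis j 1) * w $ i)"
    by (intro continuous_intros f)
  ultimately show ?thesis
    using d by (auto simp: C1_field_def differentiable_def)
qed

text \<open>Squaring the positive part removes its kink at 0. One continuous derivative is all that
  \<open>C1_field\<close> asks for, so this cutoff takes the place of a smooth bump
  function.\<close>

lemma has_real_derivative_max_0_power2: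
  "((\<lambda>t. (max 0 t)\<^sup>2) has_real_derivative 2 * max 0 t) (at (t::real))"
proof -
  consider "t < 0" | "t = 0" | "t > 0" by linarith
  then show ?thesis
  proof cases
    case 1
    then have "((\<lambda>t. 0) has_real_derivative 2 * max 0 t) (at t)" by simp
    then show ?thesis
      by (rule has_field_derivative_transform_within_open[where S = "{..<0}"]) (use 1 in auto)
  next
    case 2
    have "((\<lambda>h. (max 0 h)\<^sup>2 / h) \<longlongrightarrow> 0) (at (0::real))"
    proof (rule Lim_null_comparison)
      show "\<forall>\<^sub>F h in at (0::real). norm ((max 0 h)\<^sup>2 / h) \<le> \<bar>h\<bar>"
        by (auto simp: max_def power2_eq_square)
      show "((\<lambda>h. \<bar>h\<bar>) \<longlongrightarrow> 0) (at (0::real))"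
        by (auto intro!: tendsto_eq_intros)
    qed
    then show ?thesis using 2 by (simp add: DERIV_def)
  next
    case 3
    then have "((\<lambda>t. t\<^sup>2) has_real_derivative 2 * max 0 t) (at t)"
      by (auto intro!: derivative_eq_intros)
    then show ?thesis
      by (rule has_field_derivative_transform_within_open[where S = "{0<..}"]) (use 3 in auto)
  qed
qed

text \<open>Each factor is the squared positive part of a parabola with roots \<open>a $ i\<close>
  and \<open>b $ i\<close>. Only the set where \<open>p\<close> is positive matters:
  \<open>p\<close> is later pushed up to the indicator of the box.\<close>

lemma C1_scalar_positive_on_box:
  fixes a b :: "real ^ 'n"
  obtains p where "C1_scalar p" "\<And>x. x \<in> box a b \<Longrightarrow> p x > 0" "\<And>x. x \<notin> box a b \<Longrightarrow> p x = 0"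
proof -
  define q where "q i t = (t - a $ i) * (b $ i - t)" for i t
  define p where "p x = (\<Prod>i\<in>UNIV. if a $ i < x $ i \<and> x $ i < b $ i then (q i (x $ i))\<^sup>2 else 0)" for x :: "real ^ 'n"
  show thesis
  proof (cases "box a b = {}")
    case True
    show ?thesis
      by (rule that[of "\<lambda>x. 0"]) (use True in \<open>auto simp: C1_scalar_const\<close>)
  next
    case False
    then have ab: "a $ i < b $ i" for i
      by (auto simp: mem_box_cart set_eq_iff intro: less_trans)
    \<comment> \<open>The order \<open>a $ i < b $ i\<close> matters: with the endpoints reversed
      the parabola would be positive between them, while the condition on the left would never
      hold.\<close>
    have q: "(if a $ i < t \<and> t < b $ i then (q i t)\<^sup>2 else 0) = (max 0 (q i t))\<^sup>2" for i t
      using ab[of i] by (auto simp: q_def max_def zero_le_mult_iff)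
    have dq: "(q i has_real_derivative (b $ i - t) - (t - a $ i)) (at t)" for i t
      unfolding q_def by (auto intro!: derivative_eq_intros)
    have "C1_scalar (\<lambda>x. (max 0 (q i (x $ i)))\<^sup>2)" for i
    proof (rule C1_scalar_compose[OF C1_scalar_component])
      show "((\<lambda>t. (max 0 (q i t))\<^sup>2) has_real_derivative
          2 * max 0 (q i t) * ((b $ i - t) - (t - a $ i))) (at t)" for t
        using DERIV_chain2[OF has_real_derivative_max_0_power2 dq] .
      show "continuous_on UNIV (\<lambda>t. 2 * max 0 (q i t) * ((b $ i - t) - (t - a $ i)))"
        unfolding q_def by (intro continuous_intros)
    qed
    then have "C1_scalar p" unfolding p_def q by (rule C1_scalar_prod)
    moreover have "p x > 0" if "x \<in> box a b" for x
      using that unfolding p_def by (intro prod_pos) (simp add: mem_box_cart q_def less_imp_neq[THEN not_sym] less_imp_neq)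
    moreover have "p x = 0" if "x \<notin> box a b" for x
      using that unfolding p_def by (auto simp: mem_box_cart)
    ultimately show ?thesis by (rule that)
  qed
qed

section \<open>Square integrable fields\<close>

lemma jacobian_eq_0_outside_support:
  assumes "x \<notin> closure {x. \<phi> x \<noteq> 0}"
  shows "jacobian \<phi> (at x) = 0"
proof -
  have "((\<lambda>x. 0) has_derivative (\<lambda>v. 0)) (at x)" by simp
  then have "(\<phi> has_derivative (\<lambda>v. 0)) (at x)"
    by (rule has_derivative_transform_within_open[where s = "- closure {x. \<phi> x \<noteq> 0}"])
      (use assms closure_subset[of "{x. \<phi> x \<noteq> 0}"] in auto)
  then show ?thesis
    by (simp add: jacobian_def frechet_derivative_at[symmetric] matrix_def vec_eq_iff)
qed

lemma L2_iff:
  fixes f :: "real ^ 'n \<Rightarrow> 'b::euclidean_space"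
  assumes "G \<in> sets lebesgue"
  shows "f \<in> L2 G \<longleftrightarrow> (\<lambda>x. indicator G x *\<^sub>R f x) \<in> borel_measurable lebesgue \<and>
    integrable lebesgue (\<lambda>x. indicator G x * (norm (f x))\<^sup>2)"
  using assms unfolding L2_def
  by (simp add: borel_measurable_restrict_space_iff integrable_restrict_space)

lemma ae_eq_iff: "G \<in> sets lebesgue \<Longrightarrow> ae_eq G f g \<longleftrightarrow> (AE x in lebesgue. x \<in> G \<longrightarrow> f x = g x)"
  unfolding ae_eq_def by (simp add: AE_restrict_space_iff)

lemma ae_eq_refl: "ae_eq G f f"
  by (simp add: ae_eq_def)

lemma ae_eq_sym: "ae_eq G f g \<Longrightarrow> ae_eq G g f"
  by (auto simp: ae_eq_def)

lemma ae_eq_subset: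
  "ae_eq G f g \<Longrightarrow> H \<subseteq> G \<Longrightarrow> G \<in> sets lebesgue \<Longrightarrow> H \<in> sets lebesgue \<Longrightarrow> ae_eq H f g"
  by (auto simp: ae_eq_iff)

lemma ae_eq_add: "ae_eq G f f' \<Longrightarrow> ae_eq G g g' \<Longrightarrow> ae_eq G (\<lambda>x. f x + g x) (\<lambda>x. f' x + g' x)"
  by (auto simp: ae_eq_def)

lemma ae_eq_scaleR: "ae_eq G f f' \<Longrightarrow> ae_eq G (\<lambda>x. c *\<^sub>R f x) (\<lambda>x. c *\<^sub>R f' x)"
  by (auto simp: ae_eq_def)

lemma L2_measurable [measurable_dest]: "f \<in> L2 G \<Longrightarrow> f \<in> borel_measurable (lebesgue_on G)"
  by (simp add: L2_def)

lemma L2_bound: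
  assumes f: "f \<in> L2 G" and [measurable]: "g \<in> borel_measurable (lebesgue_on G)"
    and le: "AE x in lebesgue_on G. norm (g x) \<le> c * norm (f x)"
  shows "g \<in> L2 G"
proof -
  have "integrable (lebesgue_on G) (\<lambda>x. c\<^sup>2 * (norm (f x))\<^sup>2)"
    using f by (simp add: L2_def)
  then have "integrable (lebesgue_on G) (\<lambda>x. (norm (g x))\<^sup>2)"
  proof (rule Bochner_Integration.integrable_bound)
    show "AE x in lebesgue_on G. norm ((norm (g x))\<^sup>2) \<le> norm (c\<^sup>2 * (norm (f x))\<^sup>2)"
      using le
    proof eventually_elim
      case (elim x)
      then have "(norm (g x))\<^sup>2 \<le> (c * norm (f x))\<^sup>2" by (intro power_mono) auto
      then show ?case by (simp add: power_mult_distrib)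
    qed
  qed measurable
  then show ?thesis by (simp add: L2_def)
qed

lemma L2_integrable_inner:
  assumes "f \<in> L2 G" "g \<in> L2 G"
  shows "integrable (lebesgue_on G) (\<lambda>x. f x \<bullet> g x)"
proof (rule Bochner_Integration.integrable_bound)
  show "integrable (lebesgue_on G) (\<lambda>x. (norm (f x))\<^sup>2 + (norm (g x))\<^sup>2)"
    using assms by (auto simp: L2_def)
  show "(\<lambda>x. f x \<bullet> g x) \<in> borel_measurable (lebesgue_on G)"
    using assms by (auto simp: L2_def)
  have "\<bar>a \<bullet> b\<bar> \<le> (norm a)\<^sup>2 + (norm b)\<^sup>2" for a b :: 'b
  proof -
    have "\<bar>a \<bullet> b\<bar> \<le> norm a * norm b" by (rule Cauchy_Schwarz_ineq2)
    also have "\<dots> \<le> (norm a)\<^sup>2 + (norm b)\<^sup>2"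
      using sum_squares_bound[of "norm a" "norm b"]
        mult_nonneg_nonneg[OF norm_ge_zero[of a] norm_ge_zero[of b]] by linarith
    finally show ?thesis .
  qed
  then show "AE x in lebesgue_on G. norm (f x \<bullet> g x) \<le> norm ((norm (f x))\<^sup>2 + (norm (g x))\<^sup>2)"
    by simp
qed

lemma L2_add:
  assumes "f \<in> L2 G" "g \<in> L2 G"
  shows "(\<lambda>x. f x + g x) \<in> L2 G"
proof -
  have "integrable (lebesgue_on G) (\<lambda>x. (norm (f x))\<^sup>2 + (norm (g x))\<^sup>2 + 2 * (f x \<bullet> g x))"
    using assms L2_integrable_inner[OF assms] by (auto simp: L2_def)
  also have "(\<lambda>x. (norm (f x))\<^sup>2 + (norm (g x))\<^sup>2 + 2 * (f x \<bullet> g x)) = (\<lambda>x. (norm (f x + g x))\<^sup>2)"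
    by (simp add: fun_eq_iff power2_norm_eq_inner inner_simps inner_commute)
  finally show ?thesis using assms by (auto simp: L2_def)
qed

lemma L2_scaleR: "f \<in> L2 G \<Longrightarrow> (\<lambda>x. c *\<^sub>R f x) \<in> L2 G"
  by (rule L2_bound[where f = f and c = "\<bar>c\<bar>"]) (auto dest: L2_measurable)

lemma L2_cong_ae:
  assumes f: "f \<in> L2 G" and fg: "ae_eq G f g" and G: "G \<in> sets lebesgue"
  shows "g \<in> L2 G"
proof (rule L2_bound[OF f, where c = 1])
  have "(\<lambda>x. indicator G x *\<^sub>R f x) \<in> borel_measurable lebesgue"
    using f G by (simp add: L2_iff)
  moreover have "AE x in lebesgue. indicator G x *\<^sub>R f x = indicator G x *\<^sub>R g x"
    using fg G by (auto simp: ae_eq_iff indicator_def)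
  \<comment> \<open>Measurability survives a change on a null set because the Lebesgue measure is
    complete.\<close>
  ultimately have "(\<lambda>x. indicator G x *\<^sub>R g x) \<in> borel_measurable lebesgue"
    using completion.complete2 by (metis borel_measurable_AE)
  then show "g \<in> borel_measurable (lebesgue_on G)"
    using G by (simp add: borel_measurable_restrict_space_iff)
  show "AE x in lebesgue_on G. norm (g x) \<le> 1 * norm (f x)"
    using fg by (auto simp: ae_eq_def)
qed

lemma L2_subset:
  fixes f :: "real ^ 'n \<Rightarrow> 'b::euclidean_space"
  assumes "f \<in> L2 G" "H \<subseteq> G" "G \<in> sets lebesgue" "H \<in> sets lebesgue"
  shows "f \<in> L2 H"
proof -
  have "f \<in> borel_measurable (lebesgue_on H)"
    using measurable_restrict_mono[OF L2_measurable[OF assms(1)] assms(2)] .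
  moreover have "set_integrable lebesgue G (\<lambda>x. (norm (f x))\<^sup>2)"
    using assms by (simp add: L2_def set_integrable_def integrable_restrict_space)
  then have "set_integrable lebesgue H (\<lambda>x. (norm (f x))\<^sup>2)"
    using set_integrable_subset assms by blast
  ultimately show ?thesis
    using assms by (simp add: L2_def set_integrable_def integrable_restrict_space)
qed

lemma continuous_imp_L2:
  fixes f :: "real ^ 'n \<Rightarrow> 'b::euclidean_space"
  assumes f: "continuous_on UNIV f" and "bounded G" and G: "G \<in> sets lebesgue"
  shows "f \<in> L2 G"
proof -
  obtain a b where ab: "G \<subseteq> cbox a b"
    using assms bounded_subset_cbox_symmetric by blast
  have "(\<lambda>x. (norm (f x))\<^sup>2) absolutely_integrable_on cbox a b"
    by (intro absolutely_integrable_continuous continuous_intros continuous_on_subset[OF f]) auto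
  then have "f \<in> L2 (cbox a b)"
    using continuous_imp_measurable_on_sets_lebesgue[OF continuous_on_subset[OF f]]
    by (simp add: L2_def set_integrable_def integrable_restrict_space)
  then show ?thesis by (rule L2_subset[OF _ ab _ G]) auto
qed

lemma C1_field_L2:
  fixes \<phi> :: "real ^ 'n \<Rightarrow> real ^ 'n"
  assumes "C1_field \<phi>" "bounded G" "G \<in> sets lebesgue"
  shows "\<phi> \<in> L2 G" and "(\<lambda>x. jacobian \<phi> (at x)) \<in> L2 G"
  using assms unfolding C1_field_def
  by (auto intro!: continuous_imp_L2 continuous_at_imp_continuous_on
      differentiable_imp_continuous_within)

section \<open>The L2 inner product modulo null sets\<close>

lemma ip_commute: "ip G f g = ip G g f"
  by (simp add: ip_def inner_commute)

lemma ip_add_left: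
  "f \<in> L2 G \<Longrightarrow> g \<in> L2 G \<Longrightarrow> k \<in> L2 G \<Longrightarrow> ip G (\<lambda>x. f x + g x) k = ip G f k + ip G g k"
  by (simp add: ip_def inner_add_left L2_integrable_inner)

lemma ip_add_right:
  "f \<in> L2 G \<Longrightarrow> g \<in> L2 G \<Longrightarrow> k \<in> L2 G \<Longrightarrow> ip G k (\<lambda>x. f x + g x) = ip G k f + ip G k g"
  by (simp add: ip_def inner_add_right L2_integrable_inner)

lemma ip_scaleR_left: "ip G (\<lambda>x. c *\<^sub>R f x) k = c * ip G f k"
  by (simp add: ip_def)

lemma ip_scaleR_right: "ip G k (\<lambda>x. c *\<^sub>R f x) = c * ip G k f"
  by (simp add: ip_def)

lemma ip_cong_ae_left:
  assumes "f \<in> L2 G" "ae_eq G f f'" "k \<in> L2 G" "G \<in> sets lebesgue"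
  shows "ip G f k = ip G f' k"
  using assms L2_cong_ae[OF assms(1,2,4)] unfolding ip_def ae_eq_def
  by (intro integral_cong_AE) (auto intro!: borel_measurable_inner dest: L2_measurable)

lemma ip_cong_ae_right:
  assumes "f \<in> L2 G" "ae_eq G f f'" "k \<in> L2 G" "G \<in> sets lebesgue"
  shows "ip G k f = ip G k f'"
  using ip_cong_ae_left[OF assms] by (simp add: ip_commute)

lemma ip_zero_left: "ip G (\<lambda>x. 0) k = 0"
  by (simp add: ip_def)

lemma ip_subset:
  assumes "H \<subseteq> G" "G \<in> sets lebesgue" "H \<in> sets lebesgue" "\<And>x. x \<in> G - H \<Longrightarrow> f x \<bullet> g x = 0"
  shows "ip H f g = ip G f g"
proof -
  have "(\<lambda>x. indicator H x *\<^sub>R (f x \<bullet> g x)) = (\<lambda>x. indicator G x *\<^sub>R (f x \<bullet> g x))"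
    using assms by (fastforce simp: indicator_def)
  then show ?thesis
    using assms by (simp add: ip_def integral_restrict_space)
qed

section \<open>Weak divergence\<close>

text \<open>The indicator of a box is not C1. It is the pointwise limit of the functions
  \<open>s k\<close>, which have values in [0, 1) and vanish off the box, so dominated convergence
  with majorant \<open>\<bar>g x $ i\<bar>\<close> passes to the limit. The closed box lies in
  \<open>G\<close>, which makes the supports compact subsets of \<open>G\<close>.\<close>

lemma integral_box_eq_0_if_orthogonal_to_tests:
  fixes g :: "real ^ 'n \<Rightarrow> real ^ 'n"
  assumes g: "g \<in> L2 G" and G: "open G" "bounded G" and ab: "cbox a b \<subseteq> G"
    and orth: "\<And>\<phi>. C1_field \<phi> \<Longrightarrow> compact (closure {x. \<phi> x \<noteq> 0}) \<Longrightarrow> closure {x. \<phi> x \<noteq> 0} \<subseteq> G \<Longrightarrow>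
      ip G g \<phi> = 0"
  shows "(LINT x:box a b|lebesgue. g x $ i) = 0"
proof -
  have Gs: "G \<in> sets lebesgue" using G by auto
  obtain p where p: "C1_scalar p" "\<And>x. x \<in> box a b \<Longrightarrow> p x > 0" "\<And>x. x \<notin> box a b \<Longrightarrow> p x = 0"
    using C1_scalar_positive_on_box[of a b] by metis
  \<comment> \<open>\<open>C\<^sup>1\<close> functions, supported in the closed box, that tend to the indicator of the open box\<close>
  define s where "s k x = real k * (p x)\<^sup>2 / (1 + real k * (p x)\<^sup>2)" for k x
  \<comment> \<open>With \<open>p\<close> squared, the denominator is positive for every real
    argument; \<open>C1_scalar_compose\<close> needs an outer function that is C1 on the whole
    line.\<close>
  have pos: "1 + real k * t\<^sup>2 > 0" for k t
    by (rule add_pos_nonneg) auto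
  have C1: "C1_scalar (s k)" for k
    unfolding s_def
  proof (rule C1_scalar_compose[OF p(1)])
    show "((\<lambda>t. real k * t\<^sup>2 / (1 + real k * t\<^sup>2)) has_real_derivative
        2 * real k * t / (1 + real k * t\<^sup>2)\<^sup>2) (at t)" for t
    proof -
      have "((\<lambda>t. real k * t\<^sup>2) has_real_derivative 2 * real k * t) (at t)"
        by (auto intro!: derivative_eq_intros)
      moreover from this have "((\<lambda>t. 1 + real k * t\<^sup>2) has_real_derivative 0 + 2 * real k * t) (at t)"
        by (intro DERIV_add DERIV_const)
      ultimately have "((\<lambda>t. real k * t\<^sup>2 / (1 + real k * t\<^sup>2)) has_real_derivative
          ((2 * real k * t) * (1 + real k * t\<^sup>2) - (real k * t\<^sup>2) * (0 + 2 * real k * t)) /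
          ((1 + real k * t\<^sup>2) * (1 + real k * t\<^sup>2))) (at t)"
        using pos[of k t] by (intro DERIV_divide) auto
      also have "(2 * real k * t) * (1 + real k * t\<^sup>2) - (real k * t\<^sup>2) * (0 + 2 * real k * t) =
          2 * real k * t"
        by (simp add: algebra_simps)
      finally show ?thesis by (simp only: power2_eq_square)
    qed
    show "continuous_on UNIV (\<lambda>t. 2 * real k * t / (1 + real k * t\<^sup>2)\<^sup>2)"
      by (intro continuous_intros) (use pos in \<open>auto simp: less_imp_neq[THEN not_sym]\<close>)
  qed
  have "ip G g (\<lambda>x. s k x *\<^sub>R axis i 1) = 0" for k
  proof (rule orth)
    show "C1_field (\<lambda>x. s k x *\<^sub>R axis i 1)" by (rule C1_field_scaleR[OF C1])
    have "closure {x. s k x *\<^sub>R axis i (1::real) \<noteq> 0} \<subseteq> cbox a b"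
      by (rule closure_minimal) (use p(3) box_subset_cbox[of a b] in \<open>auto simp: s_def\<close>)
    then show "closure {x. s k x *\<^sub>R axis i (1::real) \<noteq> 0} \<subseteq> G"
      and "compact (closure {x. s k x *\<^sub>R axis i (1::real) \<noteq> 0})"
      using ab bounded_subset[OF bounded_cbox[of a b]] by (auto simp: compact_eq_bounded_closed)
  qed
  then have zero: "(\<integral>x. s k x * g x $ i \<partial>lebesgue_on G) = 0" for k
    by (simp add: ip_def inner_axis mult.commute)
  \<comment> \<open>Constant fields are square integrable on the bounded set \<open>G\<close>, so
    pairing with one shows that the components of \<open>g\<close> are integrable.\<close>
  have int: "integrable (lebesgue_on G) (\<lambda>x. g x $ i)"
    using L2_integrable_inner[OF g continuous_imp_L2[OF continuous_on_const G(2) Gs], of "axis i 1"]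
    by (simp add: inner_axis)
  note [measurable] = borel_measurable_integrable[OF int]
  have [measurable]: "s k \<in> borel_measurable (lebesgue_on G)" for k
    using C1_scalar_imp_continuous[OF C1] Gs
    by (auto intro: continuous_imp_measurable_on_sets_lebesgue continuous_on_subset)
  have [measurable]: "box a b \<in> sets (lebesgue_on G)"
    using ab box_subset_cbox[of a b] Gs by (auto simp: sets_restrict_space_iff)
  have "(\<lambda>k. \<integral>x. s k x * g x $ i \<partial>lebesgue_on G) \<longlonglongrightarrow> (\<integral>x. indicator (box a b) x * g x $ i \<partial>lebesgue_on G)"
  proof (rule integral_dominated_convergence)
    show "integrable (lebesgue_on G) (\<lambda>x. \<bar>g x $ i\<bar>)" using int by auto
    show "AE x in lebesgue_on G. norm (s k x * g x $ i) \<le> \<bar>g x $ i\<bar>" for k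
    proof (rule AE_I2)
      fix x
      have "\<bar>s k x\<bar> \<le> 1" using pos[of k "p x"] by (auto simp: s_def divide_simps)
      then show "norm (s k x * g x $ i) \<le> \<bar>g x $ i\<bar>"
        by (simp add: abs_mult mult_left_le_one_le)
    qed
    have "(\<lambda>k. s k x) \<longlonglongrightarrow> indicator (box a b) x" for x
    proof (cases "x \<in> box a b")
      case True
      then have "(p x)\<^sup>2 > 0" using p(2) by force
      then have "filterlim (\<lambda>k. 1 + real k * (p x)\<^sup>2) at_top sequentially"
        by (intro filterlim_tendsto_add_at_top[OF tendsto_const]
          filterlim_at_top_mult_tendsto_pos[OF tendsto_const] filterlim_real_sequentially) auto
      then have "(\<lambda>k. 1 - inverse (1 + real k * (p x)\<^sup>2)) \<longlonglongrightarrow> 1 - 0"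
        by (intro tendsto_intros tendsto_inverse_0_at_top)
      moreover have "s k x = 1 - inverse (1 + real k * (p x)\<^sup>2)" for k
        using pos[of k "p x"] by (simp add: s_def field_simps)
      ultimately show ?thesis using True by simp
    next
      case False
      then show ?thesis using p(3) by (simp add: s_def)
    qed
    then show "AE x in lebesgue_on G. (\<lambda>k. s k x * g x $ i) \<longlonglongrightarrow> indicator (box a b) x * g x $ i"
      by (intro AE_I2 tendsto_mult) auto
  qed measurable
  then have "(\<integral>x. indicator (box a b) x * g x $ i \<partial>lebesgue_on G) = 0"
    using zero by (simp add: LIMSEQ_const_iff)
  moreover have "(\<lambda>x. indicator G x *\<^sub>R (indicator (box a b) x * g x $ i)) =
      (\<lambda>x. indicator (box a b) x *\<^sub>R g x $ i)"
    using ab box_subset_cbox[of a b] by (auto simp: indicator_def fun_eq_iff)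
  ultimately show ?thesis
    using Gs by (simp add: integral_restrict_space set_lebesgue_integral_def)
qed

text \<open>This is the fundamental lemma of the calculus of variations. Test fields must have
  compact support in \<open>G\<close>, so the argument runs on one closed box inside
  \<open>G\<close> at a time; an open set is a countable union of such boxes, and the exceptional
  sets stay null.\<close>

lemma ae_zero_if_orthogonal_to_tests:
  fixes g :: "real ^ 'n \<Rightarrow> real ^ 'n"
  assumes g: "g \<in> L2 G" and G: "open G" "bounded G"
    and orth: "\<And>\<phi>. C1_field \<phi> \<Longrightarrow> compact (closure {x. \<phi> x \<noteq> 0}) \<Longrightarrow> closure {x. \<phi> x \<noteq> 0} \<subseteq> G \<Longrightarrow>
      ip G g \<phi> = 0"
  shows "ae_eq G g (\<lambda>x. 0)"
proof -
  have Gs: "G \<in> sets lebesgue" using G by auto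
  have local_zero: "AE x in lebesgue. x \<in> cbox c d \<longrightarrow> g x $ i = 0" if cd: "cbox c d \<subseteq> G" for c d i
  proof -
    have int: "integrable (lebesgue_on G) (\<lambda>x. g x $ i)"
      using L2_integrable_inner[OF g continuous_imp_L2[OF continuous_on_const G(2) Gs], of "axis i 1"]
      by (simp add: inner_axis)
    have "box c d \<subseteq> G" using cd box_subset_cbox by blast
    then have "set_integrable lebesgue (box c d) (\<lambda>x. g x $ i)"
      using int Gs by (intro set_integrable_subset[where A = G and B = "box c d"])
        (auto simp: set_integrable_def integrable_restrict_space)
    then have "AE x in lebesgue. indicator (box c d) x *\<^sub>R g x $ i = 0"
    proof (intro AE_zero_if_integral_boxes_zero)
      have box: "(LINT x:box a b|lebesgue. g x $ i) = 0" if "cbox a b \<subseteq> G" for a b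
        using integral_box_eq_0_if_orthogonal_to_tests[OF g G that orth] .
      then show "(\<integral>x. indicator (box c d) x *\<^sub>R g x $ i \<partial>lebesgue) = 0"
        using cd by (simp add: set_lebesgue_integral_def)
      \<comment> \<open>After the cutoff to \<open>box c d\<close>, an integral over any box is an
        integral of \<open>g\<close> over an intersection of two boxes. This is again a box, and it
        is empty or has its closure in \<open>cbox c d\<close>, hence in \<open>G\<close>.\<close>
      show "(LINT x:box a b|lebesgue. indicator (box c d) x *\<^sub>R g x $ i) = 0" for a b
      proof -
        have "(LINT x:box a b|lebesgue. indicator (box c d) x *\<^sub>R g x $ i) =
            (LINT x:box a b \<inter> box c d|lebesgue. g x $ i)"
          unfolding set_lebesgue_integral_def
          by (intro Bochner_Integration.integral_cong refl) (simp add: indicator_inter_arith)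
        also obtain a' b' where ab': "box a b \<inter> box c d = box a' b'"
          using box_Int_box by blast
        also have "(LINT x:box a' b'|lebesgue. g x $ i) = 0"
        proof (cases "box a' b' = {}")
          case False
          then have "cbox a' b' = closure (box a' b')" by simp
          also have "\<dots> \<subseteq> cbox c d"
            by (rule closure_minimal) (use ab' box_subset_cbox[of c d] in auto)
          finally show ?thesis using box cd by auto
        qed (simp add: set_lebesgue_integral_def)
        finally show ?thesis .
      qed
    qed (auto simp: set_integrable_def)
    moreover have "AE x in lebesgue. x \<notin> cbox c d - box c d"
      by (intro AE_not_in) (simp add: negligible_iff_null_sets[symmetric] negligible_frontier_interval)
    ultimately show ?thesis
      by eventually_elim (auto simp: indicator_def split: if_splits)
  qed
  obtain D where D: "countable D" "D \<subseteq> Pow G" "\<And>X. X \<in> D \<Longrightarrow> \<exists>a b. X = cbox a b" "\<Union>D = G"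
    using open_countable_Union_open_cbox[OF G(1)] by metis
  have "AE x in lebesgue. \<forall>X\<in>D. \<forall>i. x \<in> X \<longrightarrow> g x $ i = 0"
  proof (subst AE_ball_countable[OF D(1)], intro ballI)
    fix X assume "X \<in> D"
    then obtain c d where "X = cbox c d" "cbox c d \<subseteq> G" using D by blast
    then have "AE x in lebesgue. \<forall>i\<in>UNIV. x \<in> X \<longrightarrow> g x $ i = 0"
      using local_zero by (intro AE_finite_allI) auto
    then show "AE x in lebesgue. \<forall>i. x \<in> X \<longrightarrow> g x $ i = 0" by simp
  qed
  then show ?thesis
    using Gs D(4) by (auto simp: ae_eq_iff vec_eq_iff elim!: eventually_mono)
qed

section \<open>Uniqueness and linearity of the weak divergence\<close>

lemma is_weak_div_L2: "is_weak_div G \<tau> g \<Longrightarrow> g \<in> L2 G"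
  by (simp add: is_weak_div_def)

lemma Hdiv_L2: "\<tau> \<in> Hdiv G \<Longrightarrow> \<tau> \<in> L2 G"
  by (simp add: Hdiv_def)

lemma is_weak_div_wdiv: "\<tau> \<in> Hdiv G \<Longrightarrow> is_weak_div G \<tau> (wdiv G \<tau>)"
  unfolding Hdiv_def wdiv_def by (simp add: some_eq_ex[of "is_weak_div G \<tau>"])

lemma wdiv_L2: "\<tau> \<in> Hdiv G \<Longrightarrow> wdiv G \<tau> \<in> L2 G"
  by (rule is_weak_div_L2[OF is_weak_div_wdiv])

text \<open>All almost-everywhere rules for \<open>wdiv\<close> come from here through
  \<open>wdiv_ae_eq\<close>: to compute \<open>wdiv\<close> it is enough to exhibit some weak
  divergence.\<close>

lemma is_weak_div_unique:
  assumes g: "is_weak_div G \<tau> g" and k: "is_weak_div G \<tau> k" and G: "open G" "bounded G"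
  shows "ae_eq G g k"
proof -
  have L2: "g \<in> L2 G" "(\<lambda>x. (-1) *\<^sub>R k x) \<in> L2 G"
    by (rule is_weak_div_L2[OF g], rule L2_scaleR[OF is_weak_div_L2[OF k]])
  have "ae_eq G (\<lambda>x. g x + (-1) *\<^sub>R k x) (\<lambda>x. 0)"
  proof (rule ae_zero_if_orthogonal_to_tests[OF L2_add[OF L2] G])
    fix \<phi> :: "real ^ 'a \<Rightarrow> real ^ 'a"
    assume \<phi>: "C1_field \<phi>" "compact (closure {x. \<phi> x \<noteq> 0})" "closure {x. \<phi> x \<noteq> 0} \<subseteq> G"
    then have "\<phi> \<in> L2 G" using G by (intro C1_field_L2) auto
    then have "ip G (\<lambda>x. g x + (-1) *\<^sub>R k x) \<phi> = ip G g \<phi> - ip G k \<phi>"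
      by (simp only: ip_add_left[OF L2] ip_scaleR_left)
    also have "\<dots> = 0"
      using g k \<phi> by (simp add: is_weak_div_def)
    finally show "ip G (\<lambda>x. g x + (-1) *\<^sub>R k x) \<phi> = 0" .
  qed
  then show ?thesis by (auto simp: ae_eq_def)
qed

lemma is_weak_div_add:
  assumes "is_weak_div G \<sigma> g" "is_weak_div G \<tau> k" "\<sigma> \<in> L2 G" "\<tau> \<in> L2 G" and G: "open G" "bounded G"
  shows "is_weak_div G (\<lambda>x. \<sigma> x + \<tau> x) (\<lambda>x. g x + k x)"
  unfolding is_weak_div_def
proof (intro conjI allI impI)
  show "(\<lambda>x. g x + k x) \<in> L2 G"
    by (intro L2_add is_weak_div_L2[OF assms(1)] is_weak_div_L2[OF assms(2)])
  fix \<phi> :: "real ^ 'a \<Rightarrow> real ^ 'a"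
  assume \<phi>: "C1_field \<phi> \<and> compact (closure {x. \<phi> x \<noteq> 0}) \<and> closure {x. \<phi> x \<noteq> 0} \<subseteq> G"
  then have "\<phi> \<in> L2 G" "(\<lambda>x. jacobian \<phi> (at x)) \<in> L2 G"
    using G by (auto intro!: C1_field_L2)
  moreover have "g \<in> L2 G" "k \<in> L2 G" using assms(1,2) by (simp_all add: is_weak_div_L2)
  ultimately show "ip G (\<lambda>x. \<sigma> x + \<tau> x) (\<lambda>x. jacobian \<phi> (at x)) = - ip G (\<lambda>x. g x + k x) \<phi>"
    using assms \<phi> by (simp add: is_weak_div_def ip_add_left)
qed

lemma is_weak_div_scaleR:
  "is_weak_div G \<tau> g \<Longrightarrow> is_weak_div G (\<lambda>x. c *\<^sub>R \<tau> x) (\<lambda>x. c *\<^sub>R g x)"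
  by (auto simp: is_weak_div_def ip_scaleR_left intro: L2_scaleR)

lemma is_weak_div_cong_ae:
  assumes "is_weak_div G \<tau> g" "\<tau> \<in> L2 G" "ae_eq G \<tau> \<tau>'" and G: "open G" "bounded G"
  shows "is_weak_div G \<tau>' g"
  unfolding is_weak_div_def
proof (intro conjI allI impI)
  show "g \<in> L2 G" by (rule is_weak_div_L2[OF assms(1)])
  fix \<phi> :: "real ^ 'a \<Rightarrow> real ^ 'a"
  assume \<phi>: "C1_field \<phi> \<and> compact (closure {x. \<phi> x \<noteq> 0}) \<and> closure {x. \<phi> x \<noteq> 0} \<subseteq> G"
  then have "(\<lambda>x. jacobian \<phi> (at x)) \<in> L2 G"
    using G by (auto intro!: C1_field_L2)
  then have "ip G \<tau> (\<lambda>x. jacobian \<phi> (at x)) = ip G \<tau>' (\<lambda>x. jacobian \<phi> (at x))"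
    using assms by (intro ip_cong_ae_left) auto
  then show "ip G \<tau>' (\<lambda>x. jacobian \<phi> (at x)) = - ip G g \<phi>"
    using assms \<phi> by (simp add: is_weak_div_def)
qed

lemma is_weak_div_zero: "is_weak_div G (\<lambda>x. 0) (\<lambda>x. 0)"
  by (simp add: is_weak_div_def ip_def L2_def)

lemma Hdiv_add:
  "\<sigma> \<in> Hdiv G \<Longrightarrow> \<tau> \<in> Hdiv G \<Longrightarrow> open G \<Longrightarrow> bounded G \<Longrightarrow> (\<lambda>x. \<sigma> x + \<tau> x) \<in> Hdiv G"
  unfolding Hdiv_def by (auto intro!: L2_add exI is_weak_div_add)

lemma Hdiv_scaleR: "\<tau> \<in> Hdiv G \<Longrightarrow> (\<lambda>x. c *\<^sub>R \<tau> x) \<in> Hdiv G"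
  unfolding Hdiv_def by (auto intro!: L2_scaleR exI is_weak_div_scaleR)

lemma Hdiv_cong_ae:
  "\<tau> \<in> Hdiv G \<Longrightarrow> ae_eq G \<tau> \<tau>' \<Longrightarrow> open G \<Longrightarrow> bounded G \<Longrightarrow> \<tau>' \<in> Hdiv G"
  unfolding Hdiv_def using is_weak_div_cong_ae[of G \<tau> _ \<tau>'] L2_cong_ae[of \<tau> G \<tau>'] by auto

lemma Hdiv_zero: "(\<lambda>x. 0) \<in> Hdiv G"
  using is_weak_div_zero by (auto simp: Hdiv_def L2_def)

lemma wdiv_ae_eq:
  assumes "is_weak_div G \<tau> g" and "\<tau> \<in> L2 G" "open G" "bounded G"
  shows "ae_eq G (wdiv G \<tau>) g"
  using is_weak_div_unique[OF is_weak_div_wdiv assms(1,3,4)] assms(1,2) by (auto simp: Hdiv_def)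

text \<open>A test field with compact support in \<open>H\<close> is also one for \<open>G\<close>,
  and both it and its Jacobian vanish on \<open>G - H\<close>. So a weak divergence on
  \<open>G\<close> serves on \<open>H\<close> as well.\<close>

lemma Hdiv_subset:
  assumes "\<tau> \<in> Hdiv G" "H \<subseteq> G" "open G" "open H"
  shows "\<tau> \<in> Hdiv H"
proof -
  have s: "G \<in> sets lebesgue" "H \<in> sets lebesgue" using assms by auto
  obtain g where g: "is_weak_div G \<tau> g" using assms by (auto simp: Hdiv_def)
  have "is_weak_div H \<tau> g"
    unfolding is_weak_div_def
  proof (intro conjI allI impI)
    show "g \<in> L2 H" by (rule L2_subset[OF is_weak_div_L2[OF g] assms(2) s])
    fix \<phi> :: "real ^ 'a \<Rightarrow> real ^ 'a"
    assume \<phi>: "C1_field \<phi> \<and> compact (closure {x. \<phi> x \<noteq> 0}) \<and> closure {x. \<phi> x \<noteq> 0} \<subseteq> H"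
    have "\<phi> x = 0" "jacobian \<phi> (at x) = 0" if "x \<in> G - H" for x
    proof -
      have "x \<notin> closure {x. \<phi> x \<noteq> 0}" using \<phi> that by blast
      then show "\<phi> x = 0" "jacobian \<phi> (at x) = 0"
        using closure_subset[of "{x. \<phi> x \<noteq> 0}"] jacobian_eq_0_outside_support[of x \<phi>] by auto
    qed
    then have "ip H \<tau> (\<lambda>x. jacobian \<phi> (at x)) = ip G \<tau> (\<lambda>x. jacobian \<phi> (at x))"
      and "ip H g \<phi> = ip G g \<phi>"
      using assms(2) s by (auto intro!: ip_subset)
    then show "ip H \<tau> (\<lambda>x. jacobian \<phi> (at x)) = - ip H g \<phi>"
      using g \<phi> assms(2) by (auto simp: is_weak_div_def)
  qed
  moreover have "\<tau> \<in> L2 H" by (rule L2_subset[OF Hdiv_L2[OF assms(1)] assms(2) s])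
  ultimately show ?thesis by (auto simp: Hdiv_def)
qed

section \<open>Normal traces and local problems\<close>

lemma normal_pairing_add:
  assumes "\<sigma> \<in> Hdiv G" "\<tau> \<in> Hdiv G" "C1_field \<phi>" and G: "open G" "bounded G"
  shows "normal_pairing G (\<lambda>x. \<sigma> x + \<tau> x) \<phi> = normal_pairing G \<sigma> \<phi> + normal_pairing G \<tau> \<phi>"
proof -
  have Gs: "G \<in> sets lebesgue" using G by auto
  note L2 = C1_field_L2[OF assms(3) G(2) Gs] wdiv_L2 Hdiv_L2 assms
  have "ip G (wdiv G (\<lambda>x. \<sigma> x + \<tau> x)) \<phi> = ip G (\<lambda>x. wdiv G \<sigma> x + wdiv G \<tau> x) \<phi>"
    by (intro ip_cong_ae_left wdiv_ae_eq is_weak_div_add is_weak_div_wdiv L2_add Hdiv_add L2 Gs)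
  then show ?thesis
    by (simp add: normal_pairing_def ip_add_left L2)
qed

lemma normal_pairing_scaleR:
  assumes "\<tau> \<in> Hdiv G" "C1_field \<phi>" and G: "open G" "bounded G"
  shows "normal_pairing G (\<lambda>x. c *\<^sub>R \<tau> x) \<phi> = c * normal_pairing G \<tau> \<phi>"
proof -
  have Gs: "G \<in> sets lebesgue" using G by auto
  have "ip G (wdiv G (\<lambda>x. c *\<^sub>R \<tau> x)) \<phi> = ip G (\<lambda>x. c *\<^sub>R wdiv G \<tau> x) \<phi>"
    by (intro ip_cong_ae_left wdiv_ae_eq is_weak_div_scaleR is_weak_div_wdiv wdiv_L2 L2_scaleR Hdiv_L2
        Hdiv_scaleR C1_field_L2[OF assms(2) G(2) Gs] assms Gs)
  then show ?thesis
    by (simp add: normal_pairing_def ip_scaleR_left distrib_left)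
qed

text \<open>The zero field is a weak divergence of \<open>\<tau>\<close>, so both terms of Green's
  formula vanish whichever representative \<open>wdiv\<close> selects. This is applied to local
  stresses of zero energy.\<close>

lemma normal_pairing_ae_zero:
  assumes "ae_eq G \<tau> (\<lambda>x. 0)" "C1_field \<phi>" and G: "open G" "bounded G"
  shows "normal_pairing G \<tau> \<phi> = 0"
proof -
  have Gs: "G \<in> sets lebesgue" using G by auto
  have zero: "ae_eq G (\<lambda>x. 0) \<tau>" by (rule ae_eq_sym[OF assms(1)])
  have \<tau>: "\<tau> \<in> Hdiv G" by (rule Hdiv_cong_ae[OF Hdiv_zero zero G])
  have "is_weak_div G \<tau> (\<lambda>x. 0)"
    by (rule is_weak_div_cong_ae[OF is_weak_div_zero Hdiv_L2[OF Hdiv_zero] zero G])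
  then have "ip G (wdiv G \<tau>) \<phi> = ip G (\<lambda>x. 0) \<phi>"
    by (intro ip_cong_ae_left wdiv_ae_eq wdiv_L2 Hdiv_L2 \<tau> C1_field_L2[OF assms(2) G(2) Gs] G Gs)
  moreover have "ip G \<tau> (\<lambda>x. jacobian \<phi> (at x)) = ip G (\<lambda>x. 0) (\<lambda>x. jacobian \<phi> (at x))"
    by (intro ip_cong_ae_left Hdiv_L2 \<tau> assms C1_field_L2[OF assms(2) G(2) Gs] Gs)
  ultimately show ?thesis by (simp add: normal_pairing_def ip_zero_left)
qed

lemma rigid_motions_C1: "\<rho> \<in> rigid_motions \<Longrightarrow> C1_field \<rho>"
proof -
  assume "\<rho> \<in> rigid_motions"
  then obtain a B where \<rho>: "\<rho> = (\<lambda>x. a + B *v x)" by (auto simp: rigid_motions_def)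
  have d: "(\<rho> has_derivative (\<lambda>v. B *v v)) (at x)" for x
    unfolding \<rho> by (auto intro!: derivative_eq_intros bounded_linear_imp_has_derivative
        matrix_vector_mul_bounded_linear)
  then have "jacobian \<rho> (at x) = B" for x
    by (simp add: jacobian_def frechet_derivative_at[OF d, symmetric])
  then show ?thesis using d by (auto simp: C1_field_def differentiable_def)
qed

section \<open>Restrictions to subdomains and the energy of the compliance tensor\<close>

lemma restriction_self: "f \<in> S \<Longrightarrow> f \<in> restriction G S"
  by (auto simp: restriction_def intro: ae_eq_refl)

lemma restriction_add:
  assumes "field_subspace \<Omega> S" "f \<in> restriction G S" "g \<in> restriction G S"
  shows "(\<lambda>x. f x + g x) \<in> restriction G S"
  using assms unfolding restriction_def field_subspace_def by (fastforce intro: ae_eq_add)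

lemma restriction_scaleR:
  assumes "field_subspace \<Omega> S" "f \<in> restriction G S"
  shows "(\<lambda>x. c *\<^sub>R f x) \<in> restriction G S"
  using assms unfolding restriction_def field_subspace_def by (fastforce intro: ae_eq_scaleR)

lemma restriction_L2:
  assumes "S \<subseteq> L2 \<Omega>" "G \<subseteq> \<Omega>" "open G" "open \<Omega>"
  shows "restriction G S \<subseteq> L2 G"
proof
  fix g assume "g \<in> restriction G S"
  then obtain f where f: "f \<in> S" "ae_eq G g f" unfolding restriction_def by blast
  have s: "\<Omega> \<in> sets lebesgue" "G \<in> sets lebesgue" using assms(3,4) by auto
  have "f \<in> L2 \<Omega>" using f(1) assms(1) by blast
  then have "f \<in> L2 G" by (rule L2_subset[OF _ assms(2) s])
  then show "g \<in> L2 G" by (rule L2_cong_ae[OF _ ae_eq_sym[OF f(2)] s(2)])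
qed

lemma restriction_Hdiv:
  assumes "S \<subseteq> Hdiv \<Omega>" "G \<subseteq> \<Omega>" "open G" "open \<Omega>" "bounded \<Omega>"
  shows "restriction G S \<subseteq> Hdiv G"
proof
  fix g assume "g \<in> restriction G S"
  then obtain f where f: "f \<in> S" "ae_eq G g f" unfolding restriction_def by blast
  have "f \<in> Hdiv \<Omega>" using f(1) assms(1) by blast
  then have "f \<in> Hdiv G" by (rule Hdiv_subset[OF _ assms(2,4,3)])
  then show "g \<in> Hdiv G"
    by (rule Hdiv_cong_ae[OF _ ae_eq_sym[OF f(2)] assms(3) bounded_subset[OF assms(5,2)]])
qed

text \<open>Measurability is the issue: \<open>A\<close> is known to be measurable in
  \<open>x\<close> only for a fixed matrix. Expanding \<open>s x\<close> in the standard basis turns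
  the composite into a finite sum of products of measurable functions.\<close>

lemma compliance_L2:
  assumes A: "compliance_tensor \<Omega> A" and "G \<subseteq> \<Omega>" and s: "s \<in> L2 G"
  shows "(\<lambda>x. A x (s x)) \<in> L2 G"
proof -
  obtain \<alpha> where \<alpha>: "\<forall>x\<in>\<Omega>. \<forall>\<tau>. norm (A x \<tau>) \<le> \<alpha> * norm \<tau>"
    using A by (auto simp: compliance_tensor_def)
  have lin: "linear (A x)" if "x \<in> \<Omega>" for x
    using A that by (simp add: compliance_tensor_def)
  have "(\<lambda>x. A x \<tau>) \<in> borel_measurable (lebesgue_on G)" for \<tau>
    using A assms(2) unfolding compliance_tensor_def by (blast intro: measurable_restrict_mono)
  then have "(\<lambda>x. \<Sum>b\<in>Basis. (s x \<bullet> b) *\<^sub>R A x b) \<in> borel_measurable (lebesgue_on G)"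
    using L2_measurable[OF s] by (intro borel_measurable_sum borel_measurable_scaleR) auto
  also have "?this \<longleftrightarrow> (\<lambda>x. A x (s x)) \<in> borel_measurable (lebesgue_on G)"
  proof (rule measurable_cong)
    fix x assume "x \<in> space (lebesgue_on G)"
    then interpret linear "A x" using lin assms(2) by auto
    have "A x (s x) = A x (\<Sum>b\<in>Basis. (s x \<bullet> b) *\<^sub>R b)" by (simp add: euclidean_representation)
    then show "(\<Sum>b\<in>Basis. (s x \<bullet> b) *\<^sub>R A x b) = A x (s x)" by (simp add: sum scale)
  qed
  finally show ?thesis
    using \<alpha> assms(2) by (intro L2_bound[OF s, where c = \<alpha>] AE_I2) auto
qed

lemma compliance_ip_commute:
  assumes "compliance_tensor \<Omega> A" "G \<subseteq> \<Omega>"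
  shows "ip G (\<lambda>x. A x (s x)) t = ip G (\<lambda>x. A x (t x)) s"
  unfolding ip_def
proof (intro Bochner_Integration.integral_cong refl)
  fix x assume "x \<in> space (lebesgue_on G)"
  then have "A x (s x) \<bullet> t x = s x \<bullet> A x (t x)"
    using assms unfolding compliance_tensor_def by auto
  then show "A x (s x) \<bullet> t x = A x (t x) \<bullet> s x" by (simp add: inner_commute)
qed

lemma compliance_ip_pos:
  assumes A: "compliance_tensor \<Omega> A" and "G \<subseteq> \<Omega>" and s: "s \<in> L2 G"
  shows "ip G (\<lambda>x. A x (s x)) s \<ge> 0"
    and "ip G (\<lambda>x. A x (s x)) s = 0 \<Longrightarrow> ae_eq G s (\<lambda>x. 0)"
proof -
  obtain \<alpha> where \<alpha>: "\<alpha> > 0" "\<forall>x\<in>\<Omega>. \<forall>\<tau>. \<alpha> * (norm \<tau>)\<^sup>2 \<le> A x \<tau> \<bullet> \<tau>"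
    using A by (auto simp: compliance_tensor_def)
  have nonneg: "A x (s x) \<bullet> s x \<ge> 0" if "x \<in> G" for x
    using \<alpha> that assms(2) by (smt (verit) subsetD zero_le_power2 mult_nonneg_nonneg)
  have zero: "s x = 0" if "x \<in> G" "A x (s x) \<bullet> s x = 0" for x
  proof -
    have "\<alpha> * (norm (s x))\<^sup>2 \<le> A x (s x) \<bullet> s x" using \<alpha>(2) that assms(2) by blast
    then have "\<alpha> * (norm (s x))\<^sup>2 \<le> 0" using that by simp
    then show ?thesis using \<alpha>(1) by (simp add: mult_le_0_iff)
  qed
  show "ip G (\<lambda>x. A x (s x)) s \<ge> 0"
    unfolding ip_def by (intro integral_nonneg_AE AE_I2) (use nonneg in auto)
  assume "ip G (\<lambda>x. A x (s x)) s = 0"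
  then have "AE x in lebesgue_on G. A x (s x) \<bullet> s x = 0"
    unfolding ip_def
    by (subst (asm) integral_nonneg_eq_0_iff_AE)
      (use nonneg L2_integrable_inner[OF compliance_L2[OF assms] s] in auto)
  moreover have "AE x in lebesgue_on G. x \<in> G" by (intro AE_I2) auto
  ultimately show "ae_eq G s (\<lambda>x. 0)"
    unfolding ae_eq_def by eventually_elim (use zero in auto)
qed

text \<open>The frontier of an open set can have positive measure in general. Here the absence of
  slits, \<open>interior (closure G) = G\<close>, puts every frontier point on the frontier of one
  of the finitely many polytopes, and convex sets have null frontiers.\<close>

lemma negligible_frontier_polygonal_domain:
  assumes "polygonal_domain G"
  shows "negligible (frontier G)"
proof -
  obtain P where P: "finite P" "\<forall>p\<in>P. polytope p" "closure G = \<Union>P" and int: "interior (closure G) = G"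
    and "open G"
    using assms unfolding polygonal_domain_def by blast
  have "frontier G = \<Union>P - interior (\<Union>P)"
    using P(3) int \<open>open G\<close> by (simp add: frontier_def interior_open)
  also have "\<dots> \<subseteq> (\<Union>p\<in>P. frontier p)"
  proof
    fix x assume x: "x \<in> \<Union>P - interior (\<Union>P)"
    then obtain p where "p \<in> P" "x \<in> p" by blast
    moreover have "interior p \<subseteq> interior (\<Union>P)"
      using \<open>p \<in> P\<close> by (intro interior_mono) auto
    ultimately show "x \<in> (\<Union>p\<in>P. frontier p)"
      using x closure_subset[of p] by (auto simp: frontier_def)
  qed
  finally show ?thesis
    by (rule negligible_subset[rotated])
      (use P in \<open>auto intro!: negligible_Union negligible_convex_frontier polytope_imp_convex\<close>)
qed

text \<open>The difference is written with the factor -1 so that the rules for sums and multiples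
  apply as they stand; simplification to a subtraction is switched off for this reason.\<close>

lemma normal_trace_zero_diff:
  assumes "normal_trace_eq G S \<sigma> \<tau>" "\<sigma> \<in> Hdiv G" "\<tau> \<in> Hdiv G" and G: "open G" "bounded G"
  shows "normal_trace_zero G S (\<lambda>x. \<sigma> x + (-1) *\<^sub>R \<tau> x)"
  using assms
  by (simp only: normal_trace_zero_def)
    (auto simp: normal_trace_eq_def portion_tests_def normal_pairing_add normal_pairing_scaleR Hdiv_scaleR
      simp del: scaleR_minus1_left scaleR_minus_left)

text \<open>Testing replaces \<open>\<eta>\<close> by \<open>\<sigma>'\<close> in all three terms at
  once. The gain is that \<open>\<sigma>'\<close>, unlike \<open>\<eta>\<close>, has divergence
  orthogonal to the local displacements and is itself orthogonal to the local rotations.\<close>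

lemma local_form_eq_energy:
  assumes G: "open G" "bounded G" "G = \<Omega>s i" and AL2: "\<And>s. s \<in> L2 G \<Longrightarrow> (\<lambda>x. A x (s x)) \<in> L2 G"
    and X: "field_subspace \<Omega> Xh" "restriction G Xh \<subseteq> Hdiv G"
    and V: "restriction G Vh \<subseteq> L2 G" and W: "restriction G Wh \<subseteq> L2 G"
    and \<eta>: "\<eta> \<in> restriction G Xh"
    and sol: "local_solution A n \<Omega>s Xh Vh Wh i \<mu> \<sigma> u \<gamma>"
    and sol': "local_solution A n \<Omega>s Xh Vh Wh i \<eta> \<sigma>' u' \<gamma>'"
  shows "ip G (\<lambda>x. A x (\<sigma> x)) \<eta> + ip G u (wdiv G \<eta>) + ip G \<gamma> \<eta> = ip G (\<lambda>x. A x (\<sigma> x)) \<sigma>'"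
proof -
  have Gs: "G \<in> sets lebesgue" using G by auto
  define \<delta> where "\<delta> x = \<sigma>' x + (-1) *\<^sub>R \<eta> x" for x
  have \<sigma>': "\<sigma>' \<in> restriction G Xh" and tr: "normal_trace_eq G (local_interface n \<Omega>s i) \<sigma>' \<eta>"
    using sol' G by (auto simp: local_solution_def)
  have H: "\<sigma>' \<in> Hdiv G" "\<eta> \<in> Hdiv G" using X \<eta> \<sigma>' by auto
  note L2 = Hdiv_L2[OF H(1)] Hdiv_L2[OF H(2)] wdiv_L2[OF H(1)] wdiv_L2[OF H(2)]
  have in_L2: "(\<lambda>x. A x (\<sigma> x)) \<in> L2 G" "u \<in> L2 G" "\<gamma> \<in> L2 G"
    using sol G(3) X V W AL2 Hdiv_L2 unfolding local_solution_def by blast+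
  have "\<delta> \<in> restriction G Xh"
    unfolding \<delta>_def[abs_def] by (intro restriction_add[OF X(1)] restriction_scaleR[OF X(1)] \<sigma>' \<eta>)
  then have "\<delta> \<in> local_stress0 n \<Omega>s Xh i"
    using normal_trace_zero_diff[OF tr H G(1,2)] G(3) by (simp add: local_stress0_def \<delta>_def[abs_def])
  then have "ip G (\<lambda>x. A x (\<sigma> x)) \<delta> + ip G u (wdiv G \<delta>) + ip G \<gamma> \<delta> = 0"
    using sol G(3) by (simp add: local_solution_def)
  moreover have "ip G f \<delta> = ip G f \<sigma>' - ip G f \<eta>" if "f \<in> L2 G" for f
    unfolding \<delta>_def using ip_add_right[OF L2(1) L2_scaleR[OF L2(2)] that, of "-1"]
    by (simp only: ip_scaleR_right)
  moreover have "ip G u (wdiv G \<delta>) = ip G u (wdiv G \<sigma>') - ip G u (wdiv G \<eta>)"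
  proof -
    have \<delta>: "is_weak_div G \<delta> (\<lambda>x. wdiv G \<sigma>' x + (-1) *\<^sub>R wdiv G \<eta> x)" "\<delta> \<in> Hdiv G"
      unfolding \<delta>_def[abs_def]
      by (intro is_weak_div_add is_weak_div_scaleR is_weak_div_wdiv H L2 L2_scaleR Hdiv_add Hdiv_scaleR G)+
    have "ip G u (wdiv G \<delta>) = ip G u (\<lambda>x. wdiv G \<sigma>' x + (-1) *\<^sub>R wdiv G \<eta> x)"
      by (intro ip_cong_ae_right wdiv_ae_eq \<delta> wdiv_L2 Hdiv_L2 in_L2 G Gs)
    also have "\<dots> = ip G u (wdiv G \<sigma>') - ip G u (wdiv G \<eta>)"
      using ip_add_right[OF L2(3) L2_scaleR[OF L2(4)] in_L2(2), of "-1"]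
      by (simp only: ip_scaleR_right)
    finally show ?thesis .
  qed
  \<comment> \<open>Here \<open>u\<close> and \<open>\<gamma>\<close>, which belong to the datum
    \<open>\<mu>\<close>, act as test functions in the constraints on the stress with datum
    \<open>\<eta>\<close>. Their kernel components thus never reach the form.\<close>
  moreover have "ip G u (wdiv G \<sigma>') = 0" "ip G \<gamma> \<sigma>' = 0"
    unfolding ip_commute[of G u] ip_commute[of G \<gamma>]
    using sol sol' G(3) by (simp_all add: local_solution_def)
  ultimately show ?thesis using in_L2 by simp
qed

section \<open>Dependence of the local form on its second argument\<close>

lemma local_form_add:
  assumes G: "open G" "bounded G" and "s \<in> L2 G" "u \<in> L2 G" "\<gamma> \<in> L2 G" "f \<in> Hdiv G" "g \<in> Hdiv G"
  shows "ip G s (\<lambda>x. f x + g x) + ip G u (wdiv G (\<lambda>x. f x + g x)) + ip G \<gamma> (\<lambda>x. f x + g x) =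
    (ip G s f + ip G u (wdiv G f) + ip G \<gamma> f) + (ip G s g + ip G u (wdiv G g) + ip G \<gamma> g)"
proof -
  have "ip G u (wdiv G (\<lambda>x. f x + g x)) = ip G u (\<lambda>x. wdiv G f x + wdiv G g x)"
    by (intro ip_cong_ae_right wdiv_ae_eq is_weak_div_add is_weak_div_wdiv wdiv_L2 Hdiv_L2 Hdiv_add L2_add
        assms) (use G in auto)
  then show ?thesis
    using assms by (simp add: ip_add_right Hdiv_L2 wdiv_L2)
qed

lemma local_form_scaleR:
  assumes G: "open G" "bounded G" and "u \<in> L2 G" "f \<in> Hdiv G"
  shows "ip G s (\<lambda>x. c *\<^sub>R f x) + ip G u (wdiv G (\<lambda>x. c *\<^sub>R f x)) + ip G \<gamma> (\<lambda>x. c *\<^sub>R f x) =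
    c * (ip G s f + ip G u (wdiv G f) + ip G \<gamma> f)"
proof -
  have "ip G u (wdiv G (\<lambda>x. c *\<^sub>R f x)) = ip G u (\<lambda>x. c *\<^sub>R wdiv G f x)"
    by (intro ip_cong_ae_right wdiv_ae_eq is_weak_div_scaleR is_weak_div_wdiv wdiv_L2 Hdiv_L2 Hdiv_scaleR
        L2_scaleR assms) (use G in auto)
  then show ?thesis by (simp add: ip_scaleR_right distrib_left)
qed

text \<open>This serves the direction from \<open>f = 0\<close> to \<open>b(f, f) = 0\<close>. The
  vanishing comes through the second argument, so of the solution selected for the datum
  \<open>f\<close> only square integrability is used.\<close>

lemma local_form_ae_zero:
  assumes G: "open G" "bounded G" and "s \<in> L2 G" "u \<in> L2 G" "\<gamma> \<in> L2 G" and f: "ae_eq G f (\<lambda>x. 0)"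
  shows "ip G s f + ip G u (wdiv G f) + ip G \<gamma> f = 0"
proof -
  have Gs: "G \<in> sets lebesgue" using G by auto
  have zero: "ae_eq G (\<lambda>x. 0) f" by (rule ae_eq_sym[OF f])
  have H: "f \<in> Hdiv G" by (rule Hdiv_cong_ae[OF Hdiv_zero zero G])
  have "is_weak_div G f (\<lambda>x. 0)"
    by (rule is_weak_div_cong_ae[OF is_weak_div_zero Hdiv_L2[OF Hdiv_zero] zero G])
  then have "ip G u (wdiv G f) = ip G u (\<lambda>x. 0)"
    by (intro ip_cong_ae_right wdiv_ae_eq wdiv_L2 Hdiv_L2 H assms Gs)
  moreover have "ip G k f = ip G k (\<lambda>x. 0)" if "k \<in> L2 G" for k
    by (intro ip_cong_ae_right Hdiv_L2 H f that Gs)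
  ultimately show ?thesis using assms by (simp add: ip_commute[of G _ "\<lambda>x. 0"] ip_zero_left)
qed

section \<open>Subdomains and the interface form\<close>

text \<open>Symmetry of the form is available only inside the space. Moving \<open>f + g\<close> or
  \<open>c f\<close> from the first argument to the second therefore requires that these again
  satisfy the rigid motion constraints.\<close>

lemma interface_space0_subspace:
  fixes f g :: "real ^ 'n \<Rightarrow> real ^ 'n ^ 'n"
  assumes X: "field_subspace \<Omega> X\<Gamma>"
    and sub: "\<And>i. i \<in> {1..n} \<Longrightarrow> X\<Gamma> \<subseteq> Hdiv (\<Omega>s i) \<and> open (\<Omega>s i) \<and> bounded (\<Omega>s i)"
    and f: "f \<in> interface_space0 \<Gamma>D n \<Omega>s X\<Gamma>"
  shows "g \<in> interface_space0 \<Gamma>D n \<Omega>s X\<Gamma> \<Longrightarrow> (\<lambda>x. f x + g x) \<in> interface_space0 \<Gamma>D n \<Omega>s X\<Gamma>"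
    and "(\<lambda>x. c *\<^sub>R f x) \<in> interface_space0 \<Gamma>D n \<Omega>s X\<Gamma>"
proof -
  have closed: "\<forall>f\<in>X\<Gamma>. \<forall>g\<in>X\<Gamma>. (\<lambda>x. f x + g x) \<in> X\<Gamma>" "\<forall>f\<in>X\<Gamma>. \<forall>c. (\<lambda>x. c *\<^sub>R f x) \<in> X\<Gamma>"
    by (rule X[unfolded field_subspace_def, THEN conjunct2, THEN conjunct1],
        rule X[unfolded field_subspace_def, THEN conjunct2, THEN conjunct2, THEN conjunct1])
  have fX: "f \<in> X\<Gamma>" using f by (simp add: interface_space0_def)
  show "(\<lambda>x. c *\<^sub>R f x) \<in> interface_space0 \<Gamma>D n \<Omega>s X\<Gamma>"
    unfolding interface_space0_def mem_Collect_eq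
  proof (intro conjI ballI impI)
    show "(\<lambda>x. c *\<^sub>R f x) \<in> X\<Gamma>" using closed(2) fX by blast
    fix i and \<rho> :: "real ^ 'n \<Rightarrow> real ^ 'n"
    assume i: "i \<in> {1..n}" "surface_null (frontier (\<Omega>s i) \<inter> \<Gamma>D)" and \<rho>: "\<rho> \<in> rigid_motions"
    then have "normal_pairing (\<Omega>s i) f \<rho> = 0" using f by (simp add: interface_space0_def)
    moreover have "f \<in> Hdiv (\<Omega>s i)" "open (\<Omega>s i)" "bounded (\<Omega>s i)"
      using sub[OF i(1)] fX by blast+
    ultimately show "normal_pairing (\<Omega>s i) (\<lambda>x. c *\<^sub>R f x) \<rho> = 0"
      by (simp add: normal_pairing_scaleR rigid_motions_C1[OF \<rho>])
  qed
  assume g: "g \<in> interface_space0 \<Gamma>D n \<Omega>s X\<Gamma>"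
  then have gX: "g \<in> X\<Gamma>" by (simp add: interface_space0_def)
  show "(\<lambda>x. f x + g x) \<in> interface_space0 \<Gamma>D n \<Omega>s X\<Gamma>"
    unfolding interface_space0_def mem_Collect_eq
  proof (intro conjI ballI impI)
    show "(\<lambda>x. f x + g x) \<in> X\<Gamma>" using closed(1) fX gX by blast
    fix i and \<rho> :: "real ^ 'n \<Rightarrow> real ^ 'n"
    assume i: "i \<in> {1..n}" "surface_null (frontier (\<Omega>s i) \<inter> \<Gamma>D)" and \<rho>: "\<rho> \<in> rigid_motions"
    then have "normal_pairing (\<Omega>s i) f \<rho> = 0" "normal_pairing (\<Omega>s i) g \<rho> = 0"
      using f g by (simp_all add: interface_space0_def)
    moreover have "f \<in> Hdiv (\<Omega>s i)" "g \<in> Hdiv (\<Omega>s i)" "open (\<Omega>s i)" "bounded (\<Omega>s i)"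
      using sub[OF i(1)] fX gX by blast+
    ultimately show "normal_pairing (\<Omega>s i) (\<lambda>x. f x + g x) \<rho> = 0"
      by (simp add: normal_pairing_add rigid_motions_C1[OF \<rho>])
  qed
qed

text \<open>Only the closures of the subdomains cover the domain; what the open subdomains miss lies
  on finitely many null frontiers.\<close>

lemma domain_decomposition_AE:
  assumes dd: "domain_decomposition \<kappa> \<Omega> T n \<Omega>s"
  shows "AE x in lebesgue. x \<in> \<Omega> \<longrightarrow> (\<exists>i\<in>{1..n}. x \<in> \<Omega>s i)"
proof -
  have pd: "polygonal_domain (\<Omega>s i)" if "i \<in> {1..n}" for i
    using dd that by (simp add: domain_decomposition_def)
  have cover: "closure \<Omega> = (\<Union>i\<in>{1..n}. closure (\<Omega>s i))"
    using dd by (simp add: domain_decomposition_def)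
  have "negligible (\<Union>i\<in>{1..n}. frontier (\<Omega>s i))"
    using negligible_frontier_polygonal_domain[OF pd] by (intro negligible_Union) auto
  then have "AE x in lebesgue. x \<notin> (\<Union>i\<in>{1..n}. frontier (\<Omega>s i))"
    by (intro AE_not_in) (simp add: negligible_iff_null_sets)
  then show ?thesis
  proof eventually_elim
    case (elim x)
    have "\<exists>i\<in>{1..n}. x \<in> closure (\<Omega>s i)" if "x \<in> \<Omega>"
      using that cover closure_subset[of \<Omega>] by blast
    moreover have "x \<in> \<Omega>s i" if "i \<in> {1..n}" "x \<in> closure (\<Omega>s i)" for i
      using that elim interior_subset[of "\<Omega>s i"] unfolding frontier_def by blast
    ultimately show ?case by blast
  qed
qed

text \<open>The decomposition only relates closures. An open subset of
  \<open>closure \<Omega>\<close> lies in its interior, which is \<open>\<Omega>\<close> because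
  there are no slits.\<close>

lemma domain_decomposition_subset:
  assumes "polygonal_domain \<Omega>" "domain_decomposition \<kappa> \<Omega> T n \<Omega>s" "i \<in> {1..n}"
  shows "\<Omega>s i \<subseteq> \<Omega>"
proof -
  have "\<Omega>s i \<subseteq> closure \<Omega>"
    using assms closure_subset[of "\<Omega>s i"] by (auto simp: domain_decomposition_def)
  moreover have "open (\<Omega>s i)"
    using assms by (auto simp: domain_decomposition_def polygonal_domain_def)
  ultimately have "\<Omega>s i \<subseteq> interior (closure \<Omega>)" by (rule interior_maximal)
  then show ?thesis using assms(1) by (simp add: polygonal_domain_def)
qed

text \<open>With zero interface traces, \<open>f\<close> is an interior stress on every subdomain.
  Gluing these restrictions and adding \<open>- f\<close> from \<open>X\<Gamma>\<close> decomposes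
  the zero field, and directness of the sum makes the \<open>X\<Gamma>\<close> part vanish.\<close>

lemma interface_complement_ae_zero:
  assumes dd: "domain_decomposition \<kappa> \<Omega> T n \<Omega>s" and \<Omega>: "open \<Omega>"
    and ic: "interface_complement \<Omega> n \<Omega>s Xh X\<Gamma>" and f: "f \<in> X\<Gamma>"
    and tr: "\<And>i. i \<in> {1..n} \<Longrightarrow> normal_trace_zero (\<Omega>s i) (local_interface n \<Omega>s i) f"
  shows "ae_eq \<Omega> f (\<lambda>x. 0)"
proof -
  define f' where "f' = (\<lambda>x. (-1) *\<^sub>R f x)"
  have "f' \<in> X\<Gamma>" "f \<in> Xh"
    using ic f unfolding f'_def interface_complement_def field_subspace_def by blast+
  then have loc: "\<forall>i\<in>{1..n}. f \<in> local_stress0 n \<Omega>s Xh i"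
    using tr by (simp add: local_stress0_def restriction_self)
  have "AE x in lebesgue. x \<in> \<Omega> \<longrightarrow> (\<Sum>i\<in>{1..n}. zero_ext (\<Omega>s i) f x) + f' x = 0"
    using domain_decomposition_AE[OF dd]
  proof eventually_elim
    case (elim x)
    show ?case
    proof
      assume "x \<in> \<Omega>"
      then obtain j where j: "j \<in> {1..n}" "x \<in> \<Omega>s j" using elim by blast
      \<comment> \<open>The subdomains are disjoint, so exactly one summand survives at a point of
        \<open>\<Omega>s j\<close>.\<close>
      have "zero_ext (\<Omega>s i) f x = (if i = j then f x else 0)" if "i \<in> {1..n}" for i
        using that j dd unfolding domain_decomposition_def zero_ext_def by (auto 4 3)
      then have "(\<Sum>i\<in>{1..n}. zero_ext (\<Omega>s i) f x) = (\<Sum>i\<in>{1..n}. if i = j then f x else 0)"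
        by (intro sum.cong refl)
      then show "(\<Sum>i\<in>{1..n}. zero_ext (\<Omega>s i) f x) + f' x = 0"
        using j by (simp add: f'_def)
    qed
  qed
  then have sum0: "ae_eq \<Omega> (\<lambda>x. (\<Sum>i\<in>{1..n}. zero_ext (\<Omega>s i) f x) + f' x) (\<lambda>x. 0)"
    using \<Omega> by (subst ae_eq_iff) auto
  have "\<And>\<tau> \<eta>. (\<forall>i \<in> {1..n}. \<tau> i \<in> local_stress0 n \<Omega>s Xh i) \<and> \<eta> \<in> X\<Gamma> \<and>
        ae_eq \<Omega> (\<lambda>x. (\<Sum>i \<in> {1..n}. zero_ext (\<Omega>s i) (\<tau> i) x) + \<eta> x) (\<lambda>x. 0) \<Longrightarrow>
        ae_eq \<Omega> \<eta> (\<lambda>x. 0)"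
    using ic unfolding interface_complement_def by blast
  from this[of "\<lambda>i. f" f'] have "ae_eq \<Omega> f' (\<lambda>x. 0)"
    using loc \<open>f' \<in> X\<Gamma>\<close> sum0 by simp
  then show ?thesis by (simp add: f'_def ae_eq_def)
qed

theorem lemma3p4:
  fixes \<Omega> \<Gamma>D \<Gamma>N :: "(real ^ 'n) set"
    and A :: "real ^ 'n \<Rightarrow> real ^ 'n ^ 'n \<Rightarrow> real ^ 'n ^ 'n"
    and T :: "(real ^ 'n) set set"
    and \<kappa> h c1 c2 :: real
    and Xh Wh X\<Gamma> :: "(real ^ 'n \<Rightarrow> real ^ 'n ^ 'n) set"
    and Vh :: "(real ^ 'n \<Rightarrow> real ^ 'n) set"
    and n :: nat
    and \<Omega>s :: "nat \<Rightarrow> (real ^ 'n) set"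
    and \<sigma> \<gamma> :: "nat \<Rightarrow> (real ^ 'n \<Rightarrow> real ^ 'n ^ 'n) \<Rightarrow> (real ^ 'n \<Rightarrow> real ^ 'n ^ 'n)"
    and u :: "nat \<Rightarrow> (real ^ 'n \<Rightarrow> real ^ 'n ^ 'n) \<Rightarrow> (real ^ 'n \<Rightarrow> real ^ 'n)"
  assumes "CARD('n) = 2 \<or> CARD('n) = 3"
    and "polygonal_domain \<Omega>" and "simply_connected \<Omega>"
    and "frontier \<Omega> = \<Gamma>D \<union> \<Gamma>N" and "\<not> surface_null \<Gamma>D"
    and "compliance_tensor \<Omega> A"
    and "conforming_mesh \<Omega> T" and "regular_mesh \<kappa> h T"
    and "fe_space \<Omega> T Xh" and "fe_space \<Omega> T Vh" and "fe_space \<Omega> T Wh"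
    and "Xh \<subseteq> stress_space \<Omega> \<Gamma>N" and "Vh \<subseteq> L2 \<Omega>" and "Wh \<subseteq> rotation_space \<Omega>"
    and "c1 > 0" and "c2 > 0" and "stable_triple c1 c2 \<Omega> A Xh Vh Wh"
    and "div_onto \<Omega> Xh Vh"
    and "domain_decomposition \<kappa> \<Omega> T n \<Omega>s"
    and "interface_complement \<Omega> n \<Omega>s Xh X\<Gamma>"
    and "\<And>i \<mu>. i \<in> {1..n} \<Longrightarrow> \<mu> \<in> interface_space0 \<Gamma>D n \<Omega>s X\<Gamma> \<Longrightarrow>
           local_solution A n \<Omega>s Xh Vh Wh i \<mu> (\<sigma> i \<mu>) (u i \<mu>) (\<gamma> i \<mu>)"
  shows "bilinear_form_on (interface_space0 \<Gamma>D n \<Omega>s X\<Gamma>) (interface_form A n \<Omega>s \<sigma> u \<gamma>) \<and>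
         symmetric_on (interface_space0 \<Gamma>D n \<Omega>s X\<Gamma>) (interface_form A n \<Omega>s \<sigma> u \<gamma>) \<and>
         positive_definite_on \<Omega> (interface_space0 \<Gamma>D n \<Omega>s X\<Gamma>) (interface_form A n \<Omega>s \<sigma> u \<gamma>)"
proof -
  let ?S = "interface_space0 \<Gamma>D n \<Omega>s X\<Gamma>" and ?b = "interface_form A n \<Omega>s \<sigma> u \<gamma>"
  note pd = \<open>polygonal_domain \<Omega>\<close> and dd = \<open>domain_decomposition \<kappa> \<Omega> T n \<Omega>s\<close>
    and ic = \<open>interface_complement \<Omega> n \<Omega>s Xh X\<Gamma>\<close> and A = \<open>compliance_tensor \<Omega> A\<close> and sol = assms(21)
  have \<Omega>: "open \<Omega>" "bounded \<Omega>" using pd by (auto simp: polygonal_domain_def)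
  have G: "open (\<Omega>s i)" "bounded (\<Omega>s i)" "\<Omega>s i \<in> sets lebesgue" "\<Omega>s i \<subseteq> \<Omega>" if "i \<in> {1..n}" for i
    using dd that domain_decomposition_subset[OF pd dd that]
    by (auto simp: domain_decomposition_def polygonal_domain_def)
  have Xs: "field_subspace \<Omega> Xh" "field_subspace \<Omega> X\<Gamma>" "X\<Gamma> \<subseteq> Xh"
    using \<open>fe_space \<Omega> T Xh\<close> ic by (auto simp: fe_space_def interface_complement_def)
  have "Xh \<subseteq> Hdiv \<Omega>" "Wh \<subseteq> L2 \<Omega>"
    using \<open>Xh \<subseteq> stress_space \<Omega> \<Gamma>N\<close> \<open>Wh \<subseteq> rotation_space \<Omega>\<close>
    by (auto simp: stress_space_def rotation_space_def)
  then have R: "restriction (\<Omega>s i) Xh \<subseteq> Hdiv (\<Omega>s i)" "restriction (\<Omega>s i) Vh \<subseteq> L2 (\<Omega>s i)"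
      "restriction (\<Omega>s i) Wh \<subseteq> L2 (\<Omega>s i)" if "i \<in> {1..n}" for i
    using restriction_Hdiv[of Xh \<Omega> "\<Omega>s i"] restriction_L2[of Vh \<Omega> "\<Omega>s i"] restriction_L2[of Wh \<Omega> "\<Omega>s i"]
      \<Omega> G[OF that] \<open>Vh \<subseteq> L2 \<Omega>\<close> by blast+
  have SX: "\<eta> \<in> restriction (\<Omega>s i) Xh" if "\<eta> \<in> ?S" for \<eta> i
    using that Xs(3) restriction_self[of \<eta> Xh] by (auto simp: interface_space0_def)
  have X\<Gamma>_Hdiv: "X\<Gamma> \<subseteq> Hdiv (\<Omega>s i)" if "i \<in> {1..n}" for i
    using Xs(3) R(1)[OF that] restriction_self[of _ Xh "\<Omega>s i"] by auto
  have AL2: "(\<lambda>x. A x (s x)) \<in> L2 (\<Omega>s i)" if "i \<in> {1..n}" "s \<in> L2 (\<Omega>s i)" for i s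
    using compliance_L2[OF A G(4)] that by blast
  have in_space: "\<sigma> i \<mu> \<in> restriction (\<Omega>s i) Xh" "u i \<mu> \<in> restriction (\<Omega>s i) Vh"
      "\<gamma> i \<mu> \<in> restriction (\<Omega>s i) Wh" if "i \<in> {1..n}" "\<mu> \<in> ?S" for i \<mu>
    using sol[OF that] by (auto simp: local_solution_def)
  have \<sigma>H: "\<sigma> i \<mu> \<in> Hdiv (\<Omega>s i)" if "i \<in> {1..n}" "\<mu> \<in> ?S" for i \<mu>
    using in_space(1)[OF that] R(1)[OF that(1)] by blast
  have \<sigma>L2: "\<sigma> i \<mu> \<in> L2 (\<Omega>s i)" and in_L2: "(\<lambda>x. A x (\<sigma> i \<mu> x)) \<in> L2 (\<Omega>s i)" "u i \<mu> \<in> L2 (\<Omega>s i)"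
      "\<gamma> i \<mu> \<in> L2 (\<Omega>s i)" if "i \<in> {1..n}" "\<mu> \<in> ?S" for i \<mu>
    using in_space(2,3)[OF that] R(2,3)[OF that(1)] AL2[OF that(1)] Hdiv_L2[OF \<sigma>H[OF that]] by auto
  have energy: "?b \<mu> \<eta> = (\<Sum>i\<in>{1..n}. ip (\<Omega>s i) (\<lambda>x. A x (\<sigma> i \<mu> x)) (\<sigma> i \<eta>))"
    if "\<mu> \<in> ?S" "\<eta> \<in> ?S" for \<mu> \<eta>
    unfolding interface_form_def
    by (intro sum.cong refl local_form_eq_energy[OF G(1,2) refl AL2 Xs(1) R SX[OF that(2)] sol[OF _ that(1)]
        sol[OF _ that(2)]])
  have sym: "?b \<mu> \<eta> = ?b \<eta> \<mu>" if "\<mu> \<in> ?S" "\<eta> \<in> ?S" for \<mu> \<eta>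
    unfolding energy[OF that] energy[OF that(2,1)]
    by (intro sum.cong refl compliance_ip_commute[OF A G(4)])
  have S_Hdiv: "f \<in> Hdiv (\<Omega>s i)" if "i \<in> {1..n}" "f \<in> ?S" for f i
    using that X\<Gamma>_Hdiv by (auto simp: interface_space0_def)
  have add: "?b k (\<lambda>x. f x + g x) = ?b k f + ?b k g" if "k \<in> ?S" "f \<in> ?S" "g \<in> ?S" for f g k
    unfolding interface_form_def sum.distrib[symmetric]
    by (intro sum.cong refl local_form_add G in_L2 S_Hdiv that)
  have scale: "?b k (\<lambda>x. c *\<^sub>R f x) = c * ?b k f" if "k \<in> ?S" "f \<in> ?S" for f k c
    unfolding interface_form_def sum_distrib_left
    by (intro sum.cong refl local_form_scaleR G in_L2 S_Hdiv that)
  note S_add = interface_space0_subspace(1)[OF Xs(2), where n = n and \<Omega>s = \<Omega>s and \<Gamma>D = \<Gamma>D]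
    and S_scale = interface_space0_subspace(2)[OF Xs(2), where n = n and \<Omega>s = \<Omega>s and \<Gamma>D = \<Gamma>D]
  have S_closed: "(\<lambda>x. f x + g x) \<in> ?S" "(\<lambda>x. c *\<^sub>R f x) \<in> ?S" if "f \<in> ?S" "g \<in> ?S" for f g c
    using S_add[of f g] S_scale[of f c] that X\<Gamma>_Hdiv G by auto
  have "bilinear_form_on ?S ?b"
    unfolding bilinear_form_on_def
  proof (intro conjI ballI allI)
    fix f g k assume S: "f \<in> ?S" "g \<in> ?S" "k \<in> ?S"
    show "?b k (\<lambda>x. f x + g x) = ?b k f + ?b k g" by (rule add[OF S(3,1,2)])
    then show "?b (\<lambda>x. f x + g x) k = ?b f k + ?b g k"
      using sym[OF S_closed(1)[OF S(1,2)] S(3)] sym[OF S(1,3)] sym[OF S(2,3)] by simp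
  next
    fix f k c assume S: "f \<in> ?S" "k \<in> ?S"
    show "?b k (\<lambda>x. c *\<^sub>R f x) = c * ?b k f" by (rule scale[OF S(2,1)])
    then show "?b (\<lambda>x. c *\<^sub>R f x) k = c * ?b f k"
      using sym[OF S_closed(2)[OF S] S(2)] sym[OF S] by simp
  qed
  moreover have "symmetric_on ?S ?b"
    using sym by (auto simp: symmetric_on_def)
  moreover have "positive_definite_on \<Omega> ?S ?b"
    unfolding positive_definite_on_def
  proof (intro ballI conjI iffI)
    fix f assume f: "f \<in> ?S"
    have nonneg: "ip (\<Omega>s i) (\<lambda>x. A x (\<sigma> i f x)) (\<sigma> i f) \<ge> 0" if "i \<in> {1..n}" for i
      by (rule compliance_ip_pos(1)[OF A G(4)[OF that] \<sigma>L2[OF that f]])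
    then show "0 \<le> ?b f f"
      unfolding energy[OF f f] by (rule sum_nonneg)
    show "?b f f = 0" if zero: "ae_eq \<Omega> f (\<lambda>x. 0)"
      unfolding interface_form_def
    proof (intro sum.neutral ballI local_form_ae_zero in_L2 G f)
      fix i assume i: "i \<in> {1..n}"
      show "ae_eq (\<Omega>s i) f (\<lambda>x. 0)"
        using \<Omega> G(3,4)[OF i] by (intro ae_eq_subset[OF zero]) auto
    qed
    show "ae_eq \<Omega> f (\<lambda>x. 0)" if zero: "?b f f = 0"
    proof (rule interface_complement_ae_zero[OF dd \<Omega>(1) ic])
      show "f \<in> X\<Gamma>" using f by (simp add: interface_space0_def)
      fix i assume i: "i \<in> {1..n}"
      have "ip (\<Omega>s i) (\<lambda>x. A x (\<sigma> i f x)) (\<sigma> i f) = 0"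
        using zero nonneg i unfolding energy[OF f f] by (subst (asm) sum_nonneg_eq_0_iff) auto
      then have \<sigma>0: "ae_eq (\<Omega>s i) (\<sigma> i f) (\<lambda>x. 0)"
        by (rule compliance_ip_pos(2)[OF A G(4)[OF i] \<sigma>L2[OF i f]])
      \<comment> \<open>The vanishing local stress says nothing directly about \<open>f\<close>
        inside the subdomain; only the interface trace is shared, and it is what the complement
        property of \<open>X\<Gamma>\<close> needs.\<close>
      have "normal_trace_eq (\<Omega>s i) (local_interface n \<Omega>s i) (\<sigma> i f) f"
        using sol[OF i f] by (simp add: local_solution_def)
      then show "normal_trace_zero (\<Omega>s i) (local_interface n \<Omega>s i) f"
        using normal_pairing_ae_zero[OF \<sigma>0 _ G(1,2)[OF i]]
        by (auto simp: normal_trace_eq_def normal_trace_zero_def portion_tests_def)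
    qed
  qed
  ultimately show ?thesis by blast
qed

end
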